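(* Every inner Eulerian bipartite plane multigraph is reducible.
   Context: A plane multigraph is a finite multigraph without self-loops with a fixed planar embedding; a vertex is external if it lies on the boundary of the unbounded face and internal otherwise. It is inner Eulerian if every internal vertex has even degree. Channel-preserving moves: (VC) for a vertex $v$ of degree 2 adjacent to distinct $v_1,v_2$, contract both edges at $v$ and delete resulting self-loops; (ED) delete two edges with the same pair of endpoints; (FV) for distinct adjacent $v_1,v_2$ with $\deg v_1=1$, delete $v_1,v_2$ and their incident edges. A multigraph is reducible if a finite sequence of channel-preserving moves transforms it into a graph with no edges (all vertices of degree $0$). *)

theory Defs
  imports "HOL-Analysis.Analysis"
begin

(* A multigraph: finite vertex set V, finite edge set E, each edge e has
   endpoints ends e (an ordered pair, orientation irrelevant); no self-loops. *)

definition endpoints :: "('e \<Rightarrow> 'v \<times> 'v) \<Rightarrow> 'e \<Rightarrow> 'v set" where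
  "endpoints ends e = {fst (ends e), snd (ends e)}"

definition multigraph :: "'v set \<Rightarrow> 'e set \<Rightarrow> ('e \<Rightarrow> 'v \<times> 'v) \<Rightarrow> bool" where
  "multigraph V E ends \<longleftrightarrow> finite V \<and> finite E \<and>
     (\<forall>e\<in>E. fst (ends e) \<in> V \<and> snd (ends e) \<in> V \<and> fst (ends e) \<noteq> snd (ends e))"

definition degree :: "'e set \<Rightarrow> ('e \<Rightarrow> 'v \<times> 'v) \<Rightarrow> 'v \<Rightarrow> nat" where
  "degree E ends v = card {e\<in>E. v \<in> endpoints ends e}"

definition bipartite :: "'e set \<Rightarrow> ('e \<Rightarrow> 'v \<times> 'v) \<Rightarrow> bool" where
  "bipartite E ends \<longleftrightarrow> (\<exists>S. \<forall>e\<in>E. (fst (ends e) \<in> S) \<noteq> (snd (ends e) \<in> S))"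

definition plane_embedding ::
  "'v set \<Rightarrow> 'e set \<Rightarrow> ('e \<Rightarrow> 'v \<times> 'v) \<Rightarrow> ('v \<Rightarrow> complex) \<Rightarrow> ('e \<Rightarrow> real \<Rightarrow> complex) \<Rightarrow> bool" where
  "plane_embedding V E ends pos \<gamma> \<longleftrightarrow>
     inj_on pos V \<and>
     (\<forall>e\<in>E. arc (\<gamma> e) \<and> pathstart (\<gamma> e) = pos (fst (ends e)) \<and>
              pathfinish (\<gamma> e) = pos (snd (ends e)) \<and>
              path_image (\<gamma> e) \<inter> pos ` V \<subseteq> pos ` endpoints ends e) \<and>
     (\<forall>e\<in>E. \<forall>e'\<in>E. e \<noteq> e' \<longrightarrow>
        path_image (\<gamma> e) \<inter> path_image (\<gamma> e') \<subseteq> pos ` (endpoints ends e \<inter> endpoints ends e'))"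

definition drawing ::
  "'v set \<Rightarrow> 'e set \<Rightarrow> ('v \<Rightarrow> complex) \<Rightarrow> ('e \<Rightarrow> real \<Rightarrow> complex) \<Rightarrow> complex set" where
  "drawing V E pos \<gamma> = pos ` V \<union> (\<Union>e\<in>E. path_image (\<gamma> e))"

definition outer_face ::
  "'v set \<Rightarrow> 'e set \<Rightarrow> ('v \<Rightarrow> complex) \<Rightarrow> ('e \<Rightarrow> real \<Rightarrow> complex) \<Rightarrow> complex set" where
  "outer_face V E pos \<gamma> =
     {z. z \<notin> drawing V E pos \<gamma> \<and>
         \<not> bounded (connected_component_set (- drawing V E pos \<gamma>) z)}"

definition external_vertex ::
  "'v set \<Rightarrow> 'e set \<Rightarrow> ('v \<Rightarrow> complex) \<Rightarrow> ('e \<Rightarrow> real \<Rightarrow> complex) \<Rightarrow> 'v \<Rightarrow> bool" where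
  "external_vertex V E pos \<gamma> v \<longleftrightarrow> pos v \<in> frontier (outer_face V E pos \<gamma>)"

definition internal_vertex ::
  "'v set \<Rightarrow> 'e set \<Rightarrow> ('v \<Rightarrow> complex) \<Rightarrow> ('e \<Rightarrow> real \<Rightarrow> complex) \<Rightarrow> 'v \<Rightarrow> bool" where
  "internal_vertex V E pos \<gamma> v \<longleftrightarrow> v \<in> V \<and> \<not> external_vertex V E pos \<gamma> v"

definition inner_eulerian ::
  "'v set \<Rightarrow> 'e set \<Rightarrow> ('e \<Rightarrow> 'v \<times> 'v) \<Rightarrow> ('v \<Rightarrow> complex) \<Rightarrow> ('e \<Rightarrow> real \<Rightarrow> complex) \<Rightarrow> bool" where
  "inner_eulerian V E ends pos \<gamma> \<longleftrightarrow>
     (\<forall>v\<in>V. internal_vertex V E pos \<gamma> v \<longrightarrow> even (degree E ends v))"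

type_synonym ('v, 'e) mgraph = "'v set \<times> 'e set \<times> ('e \<Rightarrow> 'v \<times> 'v)"

(* (VC): v of degree 2 with edges e1 = v v1, e2 = v v2, v1 \<noteq> v2; contract both
   edges (the merged vertex is named v1), deleting resulting self-loops,
   i.e. e1, e2 and all edges between v1 and v2. *)
definition move_VC :: "('v, 'e) mgraph \<Rightarrow> ('v, 'e) mgraph \<Rightarrow> bool" where
  "move_VC G G' \<longleftrightarrow> (case G of (V, E, ends) \<Rightarrow>
     (\<exists>v v1 v2 e1 e2. v \<in> V \<and> degree E ends v = 2 \<and> e1 \<in> E \<and> e2 \<in> E \<and> e1 \<noteq> e2 \<and>
        endpoints ends e1 = {v, v1} \<and> endpoints ends e2 = {v, v2} \<and>
        v1 \<noteq> v2 \<and> v1 \<noteq> v \<and> v2 \<noteq> v \<and>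
        G' = (V - {v, v2},
              {e\<in>E. \<not> endpoints ends e \<subseteq> {v, v1, v2}},
              (\<lambda>e. map_prod (\<lambda>x. if x = v2 then v1 else x) (\<lambda>x. if x = v2 then v1 else x) (ends e)))))"

definition move_ED :: "('v, 'e) mgraph \<Rightarrow> ('v, 'e) mgraph \<Rightarrow> bool" where
  "move_ED G G' \<longleftrightarrow> (case G of (V, E, ends) \<Rightarrow>
     (\<exists>e1 e2. e1 \<in> E \<and> e2 \<in> E \<and> e1 \<noteq> e2 \<and> endpoints ends e1 = endpoints ends e2 \<and>
        G' = (V, E - {e1, e2}, ends)))"

definition move_FV :: "('v, 'e) mgraph \<Rightarrow> ('v, 'e) mgraph \<Rightarrow> bool" where
  "move_FV G G' \<longleftrightarrow> (case G of (V, E, ends) \<Rightarrow>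
     (\<exists>v1 v2. v1 \<in> V \<and> v2 \<in> V \<and> v1 \<noteq> v2 \<and>
        (\<exists>e\<in>E. endpoints ends e = {v1, v2}) \<and> degree E ends v1 = 1 \<and>
        G' = (V - {v1, v2}, {e\<in>E. endpoints ends e \<inter> {v1, v2} = {}}, ends)))"

definition move :: "('v, 'e) mgraph \<Rightarrow> ('v, 'e) mgraph \<Rightarrow> bool" where
  "move G G' \<longleftrightarrow> move_VC G G' \<or> move_ED G G' \<or> move_FV G G'"

definition reducible :: "('v, 'e) mgraph \<Rightarrow> bool" where
  "reducible G \<longleftrightarrow> (\<exists>V' E' ends'. move\<^sup>*\<^sup>* G (V', E', ends') \<and> E' = {})"

end

(* Erasing the embedding, keep of it only the set near e of the faces on the sides of every edge e,
   with three facts: an edge set is even at all vertices iff it is a cut of the dual graph; the edges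
   at a vertex are linked by common faces; odd vertices have an edge at the outer face. These
   data survive deletions (merge the faces beside the edge) and contractions, hence the moves: FV
   deletes, one after the other, edges that lie on the outer face by then, and VC contracts twice.
   A bipartite graph with such data, without parallel edges and without vertices of degree 1 or 2,
   has no edges: bounded faces have at least 4 sides, external vertices have degree at least 3 and
   internal ones at least 4, which contradicts Euler's inequality.
   For a plane graph the data come from Janiszewski's theorem and the Jordan curve theorem: an edge
   on a cycle has exactly one face on either side of the cycle, and a bridge has a single face. *)
theory Submission
  imports Defs
begin

section \<open>Combinatorial face structures\<close>

text \<open>Performing the moves on a drawing would mean redrawing arcs at each contraction and
  analysing the complement anew at each deletion. The record kept instead changes by simple rules:
  deletion identifies names of faces, contraction leaves \<open>near\<close> as it is, and the name
  of the outer face never changes. That even sets are dual cuts says that the cycle space over GF(2)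
  is the cut space of the dual; counting this one space in two ways yields Euler's inequality, for
  disconnected graphs as well. The links between the edges at a vertex are what is left of the
  rotation system: they ensure that a vertex remains at the outer face when its edge there
  disappears. Bipartiteness serves twice: it makes the cut around a face have at least four edges,
  and it puts the two neighbours of a vertex of degree 2 on the same side, so that no edge joins
  them and contraction makes no loop.\<close>

lemma even_card_sym_diff:
  assumes "finite A" "finite B"
  shows "even (card (sym_diff A B)) \<longleftrightarrow> (even (card A) \<longleftrightarrow> even (card B))"
proof -
  have "card A = card (A - B) + card (A \<inter> B)"
    using assms by (metis card_Diff_subset_Int finite_Int card_mono inf_le1 le_add_diff_inverse2)
  moreover have "card B = card (B - A) + card (A \<inter> B)"
    using assms by (metis card_Diff_subset_Int finite_Int card_mono inf_le2 le_add_diff_inverse2 inf_commute)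
  moreover have "card (sym_diff A B) = card (A - B) + card (B - A)"
    using assms by (intro card_Un_disjoint) auto
  ultimately show ?thesis by auto
qed

definition star :: "'e set \<Rightarrow> ('e \<Rightarrow> 'v \<times> 'v) \<Rightarrow> 'v \<Rightarrow> 'e set" where
  "star E ends v = {e\<in>E. v \<in> endpoints ends e}"

lemma degree_eq_card_star: "degree E ends v = card (star E ends v)"
  by (simp add: degree_def star_def)

lemma in_star: "e \<in> star E ends v \<longleftrightarrow> e \<in> E \<and> v \<in> endpoints ends e"
  by (simp add: star_def)

lemma finite_star: "finite E \<Longrightarrow> finite (star E ends v)"
  by (simp add: star_def)

lemma sum_degree:
  assumes "finite W" "finite C"
  shows "(\<Sum>v\<in>W. degree C ends v) = (\<Sum>g\<in>C. card (endpoints ends g \<inter> W))"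
proof -
  have "(\<Sum>v\<in>W. degree C ends v) = (\<Sum>v\<in>W. \<Sum>g\<in>C. if v \<in> endpoints ends g then 1 else 0)"
    using assms(2) by (simp add: degree_def flip: sum.inter_filter)
  also have "\<dots> = (\<Sum>g\<in>C. \<Sum>v\<in>W. if v \<in> endpoints ends g then 1 else 0)"
    by (rule sum.swap)
  also have "\<dots> = (\<Sum>g\<in>C. card (endpoints ends g \<inter> W))"
    using assms(1) by (intro sum.cong) (auto simp flip: sum.inter_filter intro: arg_cong[where f = card])
  finally show ?thesis .
qed

lemma degree_insert:
  assumes "finite Q" "g \<notin> Q"
  shows "degree (insert g Q) ends v = degree Q ends v + (if v \<in> endpoints ends g then 1 else 0)"
proof -
  have "star (insert g Q) ends v = (if v \<in> endpoints ends g then insert g (star Q ends v) else star Q ends v)"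
    by (auto simp: star_def)
  then show ?thesis using assms by (simp add: degree_eq_card_star finite_star in_star)
qed

section \<open>The cycle space modulo 2 and cuts of the dual graph\<close>

definition even_edges :: "('e \<Rightarrow> 'v \<times> 'v) \<Rightarrow> 'e set \<Rightarrow> bool" where
  "even_edges ends C \<longleftrightarrow> (\<forall>v. even (degree C ends v))"

lemma even_degree_sym_diff:
  assumes "finite A" "finite B"
  shows "even (degree (sym_diff A B) ends v) \<longleftrightarrow> (even (degree A ends v) \<longleftrightarrow> even (degree B ends v))"
proof -
  have "star (sym_diff A B) ends v = sym_diff (star A ends v) (star B ends v)"
    by (auto simp: star_def)
  then show ?thesis
    using even_card_sym_diff[OF finite_star[OF assms(1)] finite_star[OF assms(2)]]
    by (metis degree_eq_card_star)
qed

lemma even_edges_sym_diff: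
  assumes "finite A" "finite B" "even_edges ends A"
  shows "even_edges ends (sym_diff A B) \<longleftrightarrow> even_edges ends B"
  using assms by (simp add: even_edges_def even_degree_sym_diff)

text \<open>A bridge has a single face beside it and is never split, just as a loop of the dual
  graph lies in no cut.\<close>

definition splits :: "'f set \<Rightarrow> 'f set \<Rightarrow> bool" where
  "splits X N \<longleftrightarrow> (\<exists>a\<in>N. a \<in> X) \<and> (\<exists>b\<in>N. b \<notin> X)"

definition dual_cut :: "'e set \<Rightarrow> ('e \<Rightarrow> 'f set) \<Rightarrow> 'f set \<Rightarrow> 'e set" where
  "dual_cut E near X = {e\<in>E. splits X (near e)}"

text \<open>With at most two faces beside an edge, being split is the sum modulo 2 of their
  memberships, hence additive in the set of faces. Three faces beside one edge would destroy
  this.\<close>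

lemma dual_cut_sym_diff:
  assumes "\<And>e. e \<in> E \<Longrightarrow> \<exists>a b. near e \<subseteq> {a, b}"
  shows "dual_cut E near (sym_diff X Y) = sym_diff (dual_cut E near X) (dual_cut E near Y)"
proof -
  have sp: "splits (sym_diff X Y) N \<longleftrightarrow> (splits X N \<noteq> splits Y N)" if "N \<subseteq> {a, b}" for N a b
  proof -
    have "N = {} \<or> N = {a} \<or> N = {b} \<or> N = {a, b}" using that by blast
    then show ?thesis by (elim disjE; simp add: splits_def; blast)
  qed
  have "splits (sym_diff X Y) (near e) \<longleftrightarrow> (splits X (near e) \<noteq> splits Y (near e))" if "e \<in> E" for e
    using assms[OF that] sp by metis
  then show ?thesis
    unfolding dual_cut_def by auto
qed

text \<open>A combinatorial record of a plane embedding: \<open>near e\<close> is the set of the (one or two)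
  faces on the sides of \<open>e\<close>. The third clause identifies the cycle space with
  the cut space of the dual graph; the last one replaces the rotation of the edges around a vertex.\<close>

definition face_structure :: "'e set \<Rightarrow> ('e \<Rightarrow> 'v \<times> 'v) \<Rightarrow> ('e \<Rightarrow> 'f set) \<Rightarrow> bool" where
  "face_structure E ends near \<longleftrightarrow>
     finite E \<and>
     (\<forall>e\<in>E. \<exists>a b. near e \<subseteq> {a, b}) \<and>
     (\<forall>C\<subseteq>E. even_edges ends C \<longleftrightarrow> (\<exists>X. C = dual_cut E near X)) \<and>
     (\<forall>v A. A \<subseteq> star E ends v \<and> A \<noteq> {} \<and> A \<noteq> star E ends v \<longrightarrow>
        (\<exists>g\<in>A. \<exists>h\<in>star E ends v - A. near g \<inter> near h \<noteq> {}))"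

lemma face_structureD:
  assumes "face_structure E ends near"
  shows "finite E" and "\<And>e. e \<in> E \<Longrightarrow> \<exists>a b. near e \<subseteq> {a, b}"
    and "\<And>C. C \<subseteq> E \<Longrightarrow> even_edges ends C \<Longrightarrow> \<exists>X. C = dual_cut E near X"
    and "\<And>X. even_edges ends (dual_cut E near X)"
    and "\<And>v A. A \<subseteq> star E ends v \<Longrightarrow> A \<noteq> {} \<Longrightarrow> A \<noteq> star E ends v \<Longrightarrow>
        \<exists>g\<in>A. \<exists>h\<in>star E ends v - A. near g \<inter> near h \<noteq> {}"
proof -
  note d = assms[unfolded face_structure_def]
  show "finite E" using d by (elim conjE)
  show "\<exists>a b. near e \<subseteq> {a, b}" if "e \<in> E" for e using d that by (elim conjE) (rule bspec)
  have sp: "even_edges ends C \<longleftrightarrow> (\<exists>X. C = dual_cut E near X)" if "C \<subseteq> E" for C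
    using d that by (elim conjE) simp
  show "\<exists>X. C = dual_cut E near X" if "C \<subseteq> E" "even_edges ends C" for C
    using sp that by simp
  have "dual_cut E near X \<subseteq> E" for X by (auto simp: dual_cut_def)
  then show "even_edges ends (dual_cut E near X)" for X
    using sp by blast
  show "\<exists>g\<in>A. \<exists>h\<in>star E ends v - A. near g \<inter> near h \<noteq> {}"
    if "A \<subseteq> star E ends v" "A \<noteq> {}" "A \<noteq> star E ends v" for v A
    using d that by (elim conjE) simp
qed

text \<open>In terms of \<open>near\<close>, a vertex is external if the outer face \<open>f0\<close> is on a side of one of its
  edges. Isolated vertices, having even degree, may be counted as external.\<close>

definition outer_vertex :: "'e set \<Rightarrow> ('e \<Rightarrow> 'v \<times> 'v) \<Rightarrow> ('e \<Rightarrow> 'f set) \<Rightarrow> 'f \<Rightarrow> 'v \<Rightarrow> bool" where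
  "outer_vertex E ends near f0 v \<longleftrightarrow> star E ends v = {} \<or> (\<exists>g\<in>star E ends v. f0 \<in> near g)"

text \<open>The inner Eulerian condition. It persists as long as outer vertices stay outer and
  parities change at outer vertices only.\<close>

definition odd_outer :: "'e set \<Rightarrow> ('e \<Rightarrow> 'v \<times> 'v) \<Rightarrow> ('e \<Rightarrow> 'f set) \<Rightarrow> 'f \<Rightarrow> bool" where
  "odd_outer E ends near f0 \<longleftrightarrow> face_structure E ends near \<and>
     (\<forall>v. odd (degree E ends v) \<longrightarrow> outer_vertex E ends near f0 v)"

section \<open>Deletion of an edge\<close>

text \<open>The faces beside \<open>e\<close> are identified. Even sets avoiding \<open>e\<close>
  are the cuts that do not separate these faces, that is, the cuts after the identification. The
  last conclusion, that both ends of an edge on \<open>f0\<close> become outer, allows their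
  parities to change.\<close>

lemma face_structure_delete:
  fixes near :: "'e \<Rightarrow> 'f set" and f0 :: 'f
  assumes fs: "face_structure E ends near" and e: "e \<in> E"
  obtains near' :: "'e \<Rightarrow> 'f set" where "face_structure (E - {e}) ends near'"
    and "\<And>v. outer_vertex E ends near f0 v \<Longrightarrow> outer_vertex (E - {e}) ends near' f0 v"
    and "\<And>v. f0 \<in> near e \<Longrightarrow> v \<in> endpoints ends e \<Longrightarrow> outer_vertex (E - {e}) ends near' f0 v"
proof -
  note D = face_structureD[OF fs]
  \<comment> \<open>The merged face is named \<open>f0\<close> if the outer face takes part, so that
    the same \<open>f0\<close> serves during all moves; otherwise any face beside \<open>e\<close>
    lends its name.\<close>
  define r where "r = (if f0 \<in> near e then f0 else SOME a. a \<in> near e)"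
  have r: "r \<in> near e" if "a \<in> near e" for a
    using that unfolding r_def by (metis someI)
  define \<phi> where "\<phi> x = (if x \<in> near e then r else x)" for x
  define near' where "near' g = \<phi> ` near g" for g
  have f0': "f0 \<in> near g \<Longrightarrow> f0 \<in> near' g" for g
    unfolding near'_def \<phi>_def r_def by (smt (verit) image_iff)
  have star': "star (E - {e}) ends v = star E ends v - {e}" for v
    by (auto simp: star_def)
  have splits': "splits X (near' g) \<longleftrightarrow> splits (\<phi> -` X) (near g)" for X g
    unfolding splits_def near'_def by auto
  have "\<not> splits (\<phi> -` X) (near e)" for X
    unfolding splits_def \<phi>_def by auto
  then have dc: "dual_cut (E - {e}) near' X = dual_cut E near (\<phi> -` X)" for X
    unfolding dual_cut_def using splits' by auto
  have share: "near' g \<inter> near' h \<noteq> {}" if "near g \<inter> near h \<noteq> {}" for g h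
    using that unfolding near'_def by auto
  have share2: "near' g \<inter> near' h \<noteq> {}" if sh: "near g \<inter> near e \<noteq> {}" "near e \<inter> near h \<noteq> {}" for g h
  proof -
    obtain a b where "a \<in> near g" "a \<in> near e" "b \<in> near h" "b \<in> near e" using sh by blast
    then have "\<phi> a = \<phi> b" by (simp add: \<phi>_def)
    with \<open>a \<in> near g\<close> \<open>b \<in> near h\<close> show ?thesis unfolding near'_def by auto
  qed
  have conn: "\<exists>g\<in>A. \<exists>h\<in>star (E - {e}) ends v - A. near' g \<inter> near' h \<noteq> {}"
    if A: "A \<subseteq> star (E - {e}) ends v" "A \<noteq> {}" "A \<noteq> star (E - {e}) ends v" for v A
  proof (cases "e \<in> star E ends v")
    case False
    then have "star (E - {e}) ends v = star E ends v" by (simp add: star')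
    then show ?thesis using D(5)[of A v] A share by metis
  next
    case True
    have "A \<subseteq> star E ends v" "A \<noteq> star E ends v" using A True by (auto simp: star')
    \<comment> \<open>The linking property is used twice, with \<open>e\<close> counted first
      outside and then inside the subset. Either one link avoids \<open>e\<close>, or
      \<open>A\<close> is linked to \<open>e\<close> and \<open>e\<close> to the rest, by faces that
      are now equal.\<close>
    from D(5)[OF this(1) A(2) this(2)] obtain g h where gh: "g \<in> A" "h \<in> star E ends v - A"
      "near g \<inter> near h \<noteq> {}" by blast
    have "insert e A \<subseteq> star E ends v" "insert e A \<noteq> star E ends v" using A True by (auto simp: star')
    from D(5)[OF this(1) _ this(2)] obtain g2 h2 where gh2: "g2 \<in> insert e A"
      "h2 \<in> star E ends v - insert e A" "near g2 \<inter> near h2 \<noteq> {}" by blast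
    show ?thesis
    proof (cases "h \<noteq> e")
      case True
      then show ?thesis using gh share unfolding star' by (intro bexI[of _ g] bexI[of _ h]) auto
    next
      case h: False
      show ?thesis
      proof (cases "g2 = e")
        case True
        then show ?thesis using gh gh2 h share2[of g h2] unfolding star'
          by (intro bexI[of _ g] bexI[of _ h2]) auto
      next
        case False
        then show ?thesis using gh2 share unfolding star' by (intro bexI[of _ g2] bexI[of _ h2]) auto
      qed
    qed
  qed
  have ends: "outer_vertex (E - {e}) ends near' f0 v" if f0: "f0 \<in> near e" and v: "v \<in> endpoints ends e" for v
  proof (cases "star E ends v = {e}")
    case True
    then show ?thesis by (simp add: outer_vertex_def star')
  next
    case False
    have "e \<in> star E ends v" using e v by (simp add: star_def)
    \<comment> \<open>\<open>e\<close> shares a face with another edge at \<open>v\<close>, and this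
      face is identified with \<open>f0\<close>.\<close>
    then obtain h where h: "h \<in> star E ends v - {e}" "near e \<inter> near h \<noteq> {}"
      using D(5)[of "{e}" v] False by auto
    then obtain a where "a \<in> near e" "a \<in> near h" by auto
    then have "f0 \<in> near' h" using f0 unfolding near'_def \<phi>_def r_def by force
    with h show ?thesis by (auto simp: outer_vertex_def star')
  qed
  show thesis
  proof
    show "face_structure (E - {e}) ends near'"
      unfolding face_structure_def
    proof (intro conjI ballI allI impI)
      fix g assume "g \<in> E - {e}"
      then obtain a b where "near g \<subseteq> {a, b}" using D(2) by blast
      then have "near' g \<subseteq> {\<phi> a, \<phi> b}" unfolding near'_def by auto
      then show "\<exists>a b. near' g \<subseteq> {a, b}" by blast
    next
      fix C assume C: "C \<subseteq> E - {e}"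
      show "even_edges ends C \<longleftrightarrow> (\<exists>X. C = dual_cut (E - {e}) near' X)"
      proof
        assume "even_edges ends C"
        then obtain X where X: "C = dual_cut E near X" using D(3)[of C] C by blast
        then have ns: "\<not> splits X (near e)" using C e unfolding dual_cut_def by auto
        \<comment> \<open>Since \<open>X\<close> does not split \<open>near e\<close>, it contains
          all faces beside \<open>e\<close> or none.\<close>
        have "\<phi> -` X = X"
          using ns r unfolding \<phi>_def splits_def by (auto split: if_splits)
        then show "\<exists>X. C = dual_cut (E - {e}) near' X" using X dc by metis
      next
        assume "\<exists>X. C = dual_cut (E - {e}) near' X"
        then show "even_edges ends C" using dc D(4) by auto
      qed
    next
      fix v A assume "A \<subseteq> star (E - {e}) ends v \<and> A \<noteq> {} \<and> A \<noteq> star (E - {e}) ends v"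
      then show "\<exists>g\<in>A. \<exists>h\<in>star (E - {e}) ends v - A. near' g \<inter> near' h \<noteq> {}" using conn by blast
    qed (use D(1) in auto)
  next
    fix v assume ov: "outer_vertex E ends near f0 v"
    show "outer_vertex (E - {e}) ends near' f0 v"
    proof (cases "f0 \<in> near e \<and> v \<in> endpoints ends e")
      case True
      then show ?thesis using ends by blast
    next
      case False
      show ?thesis
      proof (cases "star E ends v = {}")
        case True
        then show ?thesis by (simp add: outer_vertex_def star')
      next
        case sv: False
        then obtain g where g: "g \<in> star E ends v" "f0 \<in> near g"
          using ov by (auto simp: outer_vertex_def)
        then have "g \<in> star (E - {e}) ends v" using False by (auto simp: in_star)
        then show ?thesis using f0'[OF g(2)] by (auto simp: outer_vertex_def)
      qed
    qed
  qed (use ends in blast)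
qed

section \<open>Contraction of an edge\<close>

lemma even_edgesD: "even_edges ends C \<Longrightarrow> even (card (star C ends v))"
  by (simp add: even_edges_def degree_eq_card_star)

lemma star_dual_cut: "star (dual_cut E near X) ends v = {e\<in>star E ends v. splits X (near e)}"
  by (auto simp: star_def dual_cut_def)

text \<open>Replaces the picture that a face boundary entering a vertex also leaves it: a dual cut
  has even degree everywhere.\<close>

lemma face_structure_cut_not_single:
  assumes "face_structure E ends near"
  shows "{g\<in>star E ends v. splits X (near g)} \<noteq> {e}"
  using even_edgesD[OF face_structureD(4)[OF assms], of X v] unfolding star_dual_cut by auto

text \<open>An even set of the contracted graph becomes even in the old one, possibly after adding
  \<open>e\<close>, while cuts merely lose \<open>e\<close>; so \<open>near\<close> need not change.
  \<open>nopar\<close> keeps loops from arising, which \<open>degree\<close> would count once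
  instead of twice.\<close>

lemma odd_outer_contract:
  assumes oo: "odd_outer E ends near f0" and e: "e \<in> E" "endpoints ends e = {u, w}" "u \<noteq> w"
    and nopar: "\<And>g. g \<in> E \<Longrightarrow> g \<noteq> e \<Longrightarrow> \<not> endpoints ends g \<subseteq> {u, w}"
    and loopfree: "\<And>g. g \<in> E \<Longrightarrow> fst (ends g) \<noteq> snd (ends g)"
    and ends': "\<And>g. g \<in> E - {e} \<Longrightarrow> endpoints ends' g = (\<lambda>x. if x = w then u else x) ` endpoints ends g"
  shows "odd_outer (E - {e}) ends' near f0"
proof -
  have fs: "face_structure E ends near" using oo by (simp add: odd_outer_def)
  note D = face_structureD[OF fs]
  note single = face_structure_cut_not_single[OF fs]
  define s where "s x = star E ends x" for x
  have disj: "star C ends u \<inter> star C ends w = {}" if "C \<subseteq> E - {e}" for C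
  proof -
    have False if "g \<in> C" "u \<in> endpoints ends g" "w \<in> endpoints ends g" for g
      using that \<open>C \<subseteq> _\<close> nopar[of g] e(3) unfolding endpoints_def by auto
    then show ?thesis by (auto simp: in_star)
  qed
  have st: "star C ends' x = (if x = u then star C ends u \<union> star C ends w else if x = w then {} else star C ends x)"
    if C: "C \<subseteq> E - {e}" for C x
  proof (rule set_eqI)
    fix g
    show "g \<in> star C ends' x \<longleftrightarrow> g \<in> (if x = u then star C ends u \<union> star C ends w else if x = w then {} else star C ends x)"
    proof (cases "g \<in> C")
      case True
      then have "endpoints ends' g = (\<lambda>x. if x = w then u else x) ` endpoints ends g" using C ends' by blast
      then have "x \<in> endpoints ends' g \<longleftrightarrow> (if x = u then u \<in> endpoints ends g \<or> w \<in> endpoints ends g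
          else x \<noteq> w \<and> x \<in> endpoints ends g)"
        using e(3) by (auto simp: image_iff)
      then show ?thesis using True by (auto simp: in_star)
    qed (auto simp: in_star)
  qed
  have par: "even (degree C ends' x) \<longleftrightarrow> (if x = u then even (degree C ends u + degree C ends w) else x = w \<or> even (degree C ends x))"
    if C: "C \<subseteq> E - {e}" for C x
  proof -
    have "finite C" using C D(1) finite_subset by blast
    then show ?thesis
      using disj[OF C] by (simp add: degree_eq_card_star st[OF C] card_Un_disjoint finite_star)
  qed
  have deg_e: "even (degree (insert e C) ends x) \<longleftrightarrow> (even (degree C ends x) \<noteq> (x \<in> {u, w}))"
    if C: "C \<subseteq> E - {e}" for C x
  proof -
    have fin: "finite C" using C D(1) finite_subset by blast
    have "insert e C = sym_diff C {e}" using C by auto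
    moreover have "star {e} ends x = (if x \<in> {u, w} then {e} else {})" using e by (auto simp: star_def)
    ultimately show ?thesis using even_degree_sym_diff[OF fin, of "{e}" ends x]
      by (simp add: degree_eq_card_star)
  qed
  have dc: "dual_cut (E - {e}) near X = dual_cut E near X - {e}" for X
    by (auto simp: dual_cut_def)
  have even': "even_edges ends' C \<longleftrightarrow> even_edges ends C \<or> even_edges ends (insert e C)"
    if C: "C \<subseteq> E - {e}" for C
  proof
    assume L: "even_edges ends' C"
    then have uw: "even (degree C ends u) \<longleftrightarrow> even (degree C ends w)"
      using par[OF C, of u] by (simp add: even_edges_def)
    have x: "even (degree C ends x)" if "x \<notin> {u, w}" for x
      using L par[OF C, of x] that by (simp add: even_edges_def)
    show "even_edges ends C \<or> even_edges ends (insert e C)"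
    proof (cases "even (degree C ends u)")
      case True
      then have "even_edges ends C" using uw x unfolding even_edges_def by (metis insertE singletonD)
      then show ?thesis ..
    next
      case False
      then have "even_edges ends (insert e C)" using uw x unfolding even_edges_def deg_e[OF C] by blast
      then show ?thesis ..
    qed
  next
    assume "even_edges ends C \<or> even_edges ends (insert e C)"
    then show "even_edges ends' C"
      unfolding even_edges_def deg_e[OF C] par[OF C] by auto
  qed
  have suw: "e \<in> s u" "e \<in> s w" using e by (auto simp: s_def star_def)
  have s_sub: "s u - {e} = star (E - {e}) ends u" "s w - {e} = star (E - {e}) ends w" by (auto simp: s_def star_def)
  have s': "star (E - {e}) ends' x = (if x = u then (s u \<union> s w) - {e} else if x = w then {} else s x)" for x
  proof (cases "x = u \<or> x = w")
    case True
    then show ?thesis using st[of "E - {e}" x] s_sub by auto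
  next
    case False
    then have "star (E - {e}) ends x = s x" using e by (auto simp: s_def star_def)
    then show ?thesis using st[of "E - {e}" x] False by auto
  qed
  have conn: "\<exists>g\<in>A. \<exists>h\<in>star (E - {e}) ends' v - A. near g \<inter> near h \<noteq> {}"
    if A: "A \<subseteq> star (E - {e}) ends' v" "A \<noteq> {}" "A \<noteq> star (E - {e}) ends' v" for v A
  proof (cases "v = u")
    case False
    then show ?thesis using A D(5)[of A v] by (auto simp: s' s_def split: if_splits)
  next
    case True
    define B where "B = star (E - {e}) ends' u - A"
    have AB: "A \<union> B = s u \<union> s w - {e}" "A \<inter> B = {}" "B \<noteq> {}" "A \<noteq> {}"
      using A True unfolding B_def by (auto simp: s')
    show ?thesis
    proof (rule ccontr)
      assume "\<not> ?thesis"
      then have no: "near g \<inter> near h = {}" if "g \<in> A" "h \<in> B" for g h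
        using that True unfolding B_def by blast
      \<comment> \<open>\<open>P\<close> does not exhaust the star it meets, because
        \<open>e\<close> is missing, so it is linked to an edge there outside \<open>P\<close>; as
        \<open>P\<close> shares no face with \<open>Q\<close>, that edge is
        \<open>e\<close>.\<close>
      have touch: "\<exists>h\<in>P. near h \<inter> near e \<noteq> {}" if PQ: "P \<union> Q = s u \<union> s w - {e}" "P \<inter> Q = {}" "P \<noteq> {}"
        and no: "\<And>g h. g \<in> P \<Longrightarrow> h \<in> Q \<Longrightarrow> near g \<inter> near h = {}" for P Q
      proof -
        obtain x where x: "x \<in> {u, w}" "P \<inter> s x \<noteq> {}" using PQ by blast
        have "P \<inter> s x \<subseteq> star E ends x" "P \<inter> s x \<noteq> star E ends x" using suw x PQ by (auto simp: s_def)
        then obtain g h where gh: "g \<in> P \<inter> s x" "h \<in> star E ends x - P \<inter> s x" "near g \<inter> near h \<noteq> {}"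
          using D(5)[of "P \<inter> s x" x] x(2) by blast
        then have "h \<in> s x - P" by (auto simp: s_def)
        then have "h = e \<or> h \<in> Q" using PQ(1) x(1) by blast
        then show ?thesis using no gh by blast
      qed
      obtain h1 where h1: "h1 \<in> A" "near h1 \<inter> near e \<noteq> {}"
        using touch[OF AB(1,2,4) no] by blast
      obtain h2 where h2: "h2 \<in> B" "near h2 \<inter> near e \<noteq> {}"
        using touch[of B A] AB no by (metis inf_commute sup_commute)
      obtain a b where ab: "a \<in> near e" "a \<in> near h1" "b \<in> near e" "b \<in> near h2" using h1 h2 by auto
      \<comment> \<open>This set separates the two faces found beside \<open>e\<close>, but splits
        no other edge at \<open>u\<close>: its cut would have degree 1 at \<open>u\<close>.\<close>
      define X where "X = \<Union>(near ` A)"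
      have "a \<in> X" using ab h1 by (auto simp: X_def)
      moreover have "b \<notin> X" using ab h2 no by (auto simp: X_def)
      ultimately have spe: "splits X (near e)" using ab by (auto simp: splits_def)
      have spA: "\<not> splits X (near g)" if "g \<in> A" for g using that by (auto simp: splits_def X_def)
      have spB: "\<not> splits X (near g)" if "g \<in> B" for g using that no by (fastforce simp: splits_def X_def)
      have "{g\<in>star E ends u. splits X (near g)} = {e}"
        using spe spA spB AB(1) suw(1) unfolding s_def by blast
      then show False using single by blast
    qed
  qed
  have ov: "outer_vertex (E - {e}) ends' near f0 u"
    if "outer_vertex E ends near f0 u \<or> outer_vertex E ends near f0 w"
  proof (rule ccontr)
    assume no: "\<not> ?thesis"
    then have ne: "s u \<union> s w - {e} \<noteq> {}" and nf: "\<And>g. g \<in> s u \<union> s w - {e} \<Longrightarrow> f0 \<notin> near g"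
      by (auto simp: outer_vertex_def s')
    have f0e: "f0 \<in> near e" using that nf suw unfolding outer_vertex_def s_def by blast
    \<comment> \<open>With a second face beside \<open>e\<close>, the cut of \<open>{f0}\<close>
      would have degree 1 at \<open>u\<close>. So \<open>f0\<close> is alone beside
      \<open>e\<close>, and any edge linked to \<open>e\<close> is on \<open>f0\<close> too.\<close>
    have "\<not> splits {f0} (near e)"
    proof
      assume "splits {f0} (near e)"
      moreover have "\<not> splits {f0} (near g)" if "g \<in> s u - {e}" for g
        using nf[of g] that by (auto simp: splits_def)
      ultimately have "{g\<in>star E ends u. splits {f0} (near g)} = {e}" using suw(1) unfolding s_def by blast
      then show False using single by blast
    qed
    then have near_e: "near e = {f0}" using f0e unfolding splits_def by blast
    obtain x where x: "x \<in> {u, w}" "s x \<noteq> {e}" using ne by blast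
    then obtain h where "h \<in> s x - {e}" "near e \<inter> near h \<noteq> {}"
      using D(5)[of "{e}" x] suw unfolding s_def by auto
    then show False using nf[of h] x near_e by auto
  qed
  have fs': "face_structure (E - {e}) ends' near"
    unfolding face_structure_def
  proof (intro conjI ballI allI impI)
    fix C assume C: "C \<subseteq> E - {e}"
    show "even_edges ends' C \<longleftrightarrow> (\<exists>X. C = dual_cut (E - {e}) near X)"
    proof
      assume "even_edges ends' C"
      then have "even_edges ends C \<or> even_edges ends (insert e C)" using even'[OF C] by blast
      then obtain X where "C = dual_cut E near X \<or> insert e C = dual_cut E near X"
        using D(3)[of C] D(3)[of "insert e C"] C e(1) by blast
      then have "C = dual_cut (E - {e}) near X" using C unfolding dc by auto
      then show "\<exists>X. C = dual_cut (E - {e}) near X" ..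
    next
      assume "\<exists>X. C = dual_cut (E - {e}) near X"
      then obtain X where X: "C = dual_cut E near X - {e}" using dc by auto
      have "C = dual_cut E near X \<or> insert e C = dual_cut E near X" using X by auto
      then show "even_edges ends' C" using D(4)[of X] even'[OF C] by auto
    qed
  next
    fix v A assume "A \<subseteq> star (E - {e}) ends' v \<and> A \<noteq> {} \<and> A \<noteq> star (E - {e}) ends' v"
    then show "\<exists>g\<in>A. \<exists>h\<in>star (E - {e}) ends' v - A. near g \<inter> near h \<noteq> {}" using conn by blast
  qed (use D(1,2) in auto)
  have "outer_vertex (E - {e}) ends' near f0 v" if odd: "odd (degree (E - {e}) ends' v)" for v
  proof -
    have del: "even (degree E ends x) \<longleftrightarrow> (even (degree (E - {e}) ends x) \<noteq> (x \<in> {u, w}))" for x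
      using deg_e[of "E - {e}" x] e(1) by (simp add: insert_absorb)
    show ?thesis
    proof (cases "v = u")
      case True
      \<comment> \<open>The loss of \<open>e\<close> lowers both degrees by one, so the merged
        vertex has the parity of the sum of the two old degrees.\<close>
      then have "odd (degree E ends u) \<or> odd (degree E ends w)"
        using odd par[of "E - {e}" u] del[of u] del[of w] by auto
      then show ?thesis using ov oo True by (auto simp: odd_outer_def)
    next
      case False
      then have "v \<noteq> w" "odd (degree E ends v)" using odd par[of "E - {e}" v] del[of v] by auto
      then have "outer_vertex E ends near f0 v" using oo by (auto simp: odd_outer_def)
      then show ?thesis using False \<open>v \<noteq> w\<close> by (auto simp: outer_vertex_def s' s_def)
    qed
  qed
  then show ?thesis using fs' by (simp add: odd_outer_def)
qed

section \<open>Reduction moves\<close>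

text \<open>An edge is removed only while it lies on \<open>f0\<close>; its two ends, where the
  parity changes, are outer afterwards. As \<open>v\<close> thus stays outer, it has a next edge on
  \<open>f0\<close> until its star is empty.\<close>

lemma odd_outer_delete_star:
  fixes near :: "'e \<Rightarrow> 'f set"
  assumes "odd_outer E ends near f0" "outer_vertex E ends near f0 v"
  shows "\<exists>near' :: 'e \<Rightarrow> 'f set. odd_outer (E - star E ends v) ends near' f0"
  using assms
proof (induction "card (star E ends v)" arbitrary: E near)
  case 0
  then have "finite E" by (simp add: odd_outer_def face_structure_def)
  then have "star E ends v = {}" using 0 finite_star[of E ends v] by simp
  then show ?case using 0 by auto
next
  case (Suc n)
  have fs: "face_structure E ends near" using Suc.prems by (simp add: odd_outer_def)
  have fin: "finite E" by (rule face_structureD(1)[OF fs])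
  have "star E ends v \<noteq> {}" using Suc.hyps(2) by auto
  then obtain g where g: "g \<in> star E ends v" "f0 \<in> near g" using Suc.prems(2) by (auto simp: outer_vertex_def)
  then have gE: "g \<in> E" "v \<in> endpoints ends g" by (auto simp: in_star)
  obtain near' :: "'e \<Rightarrow> 'f set" where n: "face_structure (E - {g}) ends near'"
    "\<And>x. outer_vertex E ends near f0 x \<Longrightarrow> outer_vertex (E - {g}) ends near' f0 x"
    "\<And>x. f0 \<in> near g \<Longrightarrow> x \<in> endpoints ends g \<Longrightarrow> outer_vertex (E - {g}) ends near' f0 x"
    using face_structure_delete[OF fs gE(1), of f0] by metis
  have "outer_vertex (E - {g}) ends near' f0 x" if odd: "odd (degree (E - {g}) ends x)" for x
  proof (cases "x \<in> endpoints ends g")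
    case True
    then show ?thesis using n(3) g(2) by blast
  next
    case False
    then have "star (E - {g}) ends x = star E ends x" by (auto simp: star_def)
    then have "outer_vertex E ends near f0 x"
      using odd Suc.prems(1) by (simp add: odd_outer_def degree_eq_card_star)
    then show ?thesis by (rule n(2))
  qed
  then have oo: "odd_outer (E - {g}) ends near' f0" using n(1) by (simp add: odd_outer_def)
  have s: "star (E - {g}) ends v = star E ends v - {g}" by (auto simp: star_def)
  have "n = card (star (E - {g}) ends v)" using Suc.hyps(2) g(1) fin by (simp add: s finite_star)
  from Suc.hyps(1)[OF this oo n(3)[OF g(2) gE(2)]]
  obtain near'' :: "'e \<Rightarrow> 'f set" where "odd_outer (E - {g} - star (E - {g}) ends v) ends near'' f0" by blast
  moreover have "E - {g} - star (E - {g}) ends v = E - star E ends v" using g(1) s by auto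
  ultimately show ?case by auto
qed

text \<open>Between the two deletions the parities may be wrong at inner vertices, so the
  intermediate graph is known only by its face structure and its outer vertices. The second deletion
  restores all parities.\<close>

lemma odd_outer_delete_parallel:
  fixes near :: "'e \<Rightarrow> 'f set"
  assumes oo: "odd_outer E ends near f0" and e: "e1 \<in> E" "e2 \<in> E" "e1 \<noteq> e2" "endpoints ends e1 = endpoints ends e2"
  shows "\<exists>near' :: 'e \<Rightarrow> 'f set. odd_outer (E - {e1, e2}) ends near' f0"
proof -
  have fs: "face_structure E ends near" using oo by (simp add: odd_outer_def)
  obtain near1 :: "'e \<Rightarrow> 'f set" where n1: "face_structure (E - {e1}) ends near1"
    "\<And>x. outer_vertex E ends near f0 x \<Longrightarrow> outer_vertex (E - {e1}) ends near1 f0 x"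
    using face_structure_delete[OF fs e(1), of f0] by metis
  have "e2 \<in> E - {e1}" using e by blast
  then obtain near2 :: "'e \<Rightarrow> 'f set" where n2: "face_structure (E - {e1} - {e2}) ends near2"
    "\<And>x. outer_vertex (E - {e1}) ends near1 f0 x \<Longrightarrow> outer_vertex (E - {e1} - {e2}) ends near2 f0 x"
    using face_structure_delete[OF n1(1), of e2 f0] by metis
  have E2: "E - {e1} - {e2} = E - {e1, e2}" by blast
  have "finite E" by (rule face_structureD(1)[OF fs])
  then have fin: "finite (E - {e1, e2})" "finite (insert e2 (E - {e1, e2}))" by auto
  have E: "E = insert e1 (insert e2 (E - {e1, e2}))" using e by blast
  have "even (degree E ends x) \<longleftrightarrow> even (degree (E - {e1, e2}) ends x)" for x
    using degree_insert[OF fin(2), of e1 ends x] degree_insert[OF fin(1), of e2 ends x] e E by auto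
  then show ?thesis using n1 n2 oo unfolding odd_outer_def E2 by metis
qed

definition reduction_invariant :: "'v set \<Rightarrow> 'e set \<Rightarrow> ('e \<Rightarrow> 'v \<times> 'v) \<Rightarrow> ('e \<Rightarrow> 'f set) \<Rightarrow> 'f \<Rightarrow> bool" where
  "reduction_invariant V E ends near f0 \<longleftrightarrow>
     multigraph V E ends \<and> bipartite E ends \<and> odd_outer E ends near f0"

lemma other_endpoint:
  assumes "fst (ends e) \<noteq> snd (ends e)" "v \<in> endpoints ends e"
  obtains w where "endpoints ends e = {v, w}" "w \<noteq> v"
proof (cases "v = fst (ends e)")
  case True
  then show thesis using that[of "snd (ends e)"] assms(1) by (simp add: endpoints_def)
next
  case False
  then have "v = snd (ends e)" using assms(2) by (simp add: endpoints_def)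
  then show thesis using that[of "fst (ends e)"] assms(1) by (simp add: endpoints_def insert_commute)
qed

lemma bipartite_mono: "bipartite E ends \<Longrightarrow> E' \<subseteq> E \<Longrightarrow> bipartite E' ends"
  unfolding bipartite_def by blast

lemma bipartiteE:
  assumes "bipartite E ends"
  obtains S where "\<And>e v w. e \<in> E \<Longrightarrow> endpoints ends e = {v, w} \<Longrightarrow> (v \<in> S) \<noteq> (w \<in> S)"
proof -
  obtain S where S: "\<forall>e\<in>E. (fst (ends e) \<in> S) \<noteq> (snd (ends e) \<in> S)"
    using assms unfolding bipartite_def by (elim exE)
  have "(v \<in> S) \<noteq> (w \<in> S)" if "e \<in> E" "endpoints ends e = {v, w}" for e v w
    using bspec[OF S that(1)] that(2) unfolding endpoints_def doubleton_eq_iff by (elim disjE conjE) simp_all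
  then show thesis by (rule that)
qed

lemma reduce_parallel:
  fixes near :: "'e \<Rightarrow> 'f set"
  assumes inv: "reduction_invariant V E ends near f0"
    and e: "e1 \<in> E" "e2 \<in> E" "e1 \<noteq> e2" "endpoints ends e1 = endpoints ends e2"
  shows "\<exists>V' E' ends' (near' :: 'e \<Rightarrow> 'f set). move (V, E, ends) (V', E', ends') \<and>
    reduction_invariant V' E' ends' near' f0 \<and> E' \<subset> E"
proof -
  obtain near' :: "'e \<Rightarrow> 'f set" where "odd_outer (E - {e1, e2}) ends near' f0"
    using odd_outer_delete_parallel[OF _ e, of near f0] inv unfolding reduction_invariant_def by (elim conjE) blast
  moreover have "multigraph V (E - {e1, e2}) ends" "bipartite (E - {e1, e2}) ends"
    using inv bipartite_mono[of E ends "E - {e1, e2}"] by (auto simp: reduction_invariant_def multigraph_def)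
  moreover have "move (V, E, ends) (V, E - {e1, e2}, ends)"
    unfolding move_def move_ED_def using e by auto
  moreover have "E - {e1, e2} \<subset> E" using e by blast
  ultimately show ?thesis unfolding reduction_invariant_def by blast
qed

text \<open>Degree 1 is odd, so the edge at \<open>v1\<close> lies on \<open>f0\<close> and makes
  \<open>v2\<close> outer. The star of \<open>v2\<close> contains this edge and can be removed as a
  whole.\<close>

lemma reduce_leaf:
  fixes near :: "'e \<Rightarrow> 'f set"
  assumes inv: "reduction_invariant V E ends near f0" and v: "degree E ends v1 = 1"
  shows "\<exists>V' E' ends' (near' :: 'e \<Rightarrow> 'f set). move (V, E, ends) (V', E', ends') \<and>
    reduction_invariant V' E' ends' near' f0 \<and> E' \<subset> E"
proof -
  have mg: "multigraph V E ends" and oo: "odd_outer E ends near f0"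
    using inv by (auto simp: reduction_invariant_def)
  obtain e where e: "star E ends v1 = {e}"
    using v unfolding degree_eq_card_star by (auto simp: card_1_singleton_iff)
  then have eE: "e \<in> E" "v1 \<in> endpoints ends e" by (auto simp: star_def)
  then have "fst (ends e) \<noteq> snd (ends e)" using mg by (auto simp: multigraph_def)
  then obtain v2 where v2: "endpoints ends e = {v1, v2}" "v2 \<noteq> v1" using eE(2) by (rule other_endpoint)
  have V: "v1 \<in> V" "v2 \<in> V" using mg eE(1) v2(1) by (auto simp: multigraph_def endpoints_def doubleton_eq_iff)
  have es: "e \<in> star E ends v2" using eE(1) v2 by (simp add: in_star)
  have "outer_vertex E ends near f0 v1" using oo v by (simp add: odd_outer_def)
  then have "f0 \<in> near e" using e by (simp add: outer_vertex_def)
  then have "outer_vertex E ends near f0 v2" using es unfolding outer_vertex_def by blast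
  then obtain near' :: "'e \<Rightarrow> 'f set" where n: "odd_outer (E - star E ends v2) ends near' f0"
    using odd_outer_delete_star[OF oo] by blast
  have "star E ends v1 \<subseteq> star E ends v2" using e es by simp
  then have E': "{e\<in>E. endpoints ends e \<inter> {v1, v2} = {}} = E - star E ends v2" by (auto simp: star_def)
  have "multigraph (V - {v1, v2}) (E - star E ends v2) ends"
    using mg unfolding E'[symmetric] by (auto simp: multigraph_def endpoints_def)
  moreover have "bipartite (E - star E ends v2) ends"
    using inv bipartite_mono[of E ends "E - star E ends v2"] by (auto simp: reduction_invariant_def)
  moreover have "move (V, E, ends) (V - {v1, v2}, E - star E ends v2, ends)"
    unfolding move_def move_FV_def E'[symmetric] using V v v2 eE(1) by auto
  moreover have "E - star E ends v2 \<subset> E" using es eE(1) by blast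
  ultimately show ?thesis using n unfolding reduction_invariant_def by blast
qed

text \<open>The neighbours of \<open>v\<close> lie on the same side of the bipartition. Hence no
  edge joins them, the move deletes just \<open>e1\<close> and \<open>e2\<close>, and the same
  bipartition serves afterwards.\<close>

lemma reduce_degree_two:
  fixes near :: "'e \<Rightarrow> 'f set"
  assumes inv: "reduction_invariant V E ends near f0" and v: "degree E ends v = 2"
    and nopar: "inj_on (endpoints ends) E"
  shows "\<exists>V' E' ends' (near' :: 'e \<Rightarrow> 'f set). move (V, E, ends) (V', E', ends') \<and>
    reduction_invariant V' E' ends' near' f0 \<and> E' \<subset> E"
proof -
  have mg: "multigraph V E ends" and oo: "odd_outer E ends near f0"
    using inv by (auto simp: reduction_invariant_def)
  have loop: "fst (ends g) \<noteq> snd (ends g)" if "g \<in> E" for g using that mg by (simp add: multigraph_def)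
  have inV: "endpoints ends g \<subseteq> V" if "g \<in> E" for g using that mg by (simp add: multigraph_def endpoints_def)
  obtain e1 e2 where e: "star E ends v = {e1, e2}" "e1 \<noteq> e2"
    using v unfolding degree_eq_card_star by (auto simp: card_2_iff)
  then have "e1 \<in> star E ends v" "e2 \<in> star E ends v" by auto
  then have eE: "e1 \<in> E" "v \<in> endpoints ends e1" "e2 \<in> E" "v \<in> endpoints ends e2" by (auto simp: in_star)
  obtain v1 where v1: "endpoints ends e1 = {v, v1}" "v1 \<noteq> v" using loop[OF eE(1)] eE(2) by (rule other_endpoint)
  obtain v2 where v2: "endpoints ends e2 = {v, v2}" "v2 \<noteq> v" using loop[OF eE(3)] eE(4) by (rule other_endpoint)
  have v12: "v1 \<noteq> v2" using v1(1) v2(1) inj_onD[OF nopar _ eE(1,3)] e(2) by auto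
  have "bipartite E ends" using inv by (simp add: reduction_invariant_def)
  then obtain S where S: "\<And>e v w. e \<in> E \<Longrightarrow> endpoints ends e = {v, w} \<Longrightarrow> (v \<in> S) \<noteq> (w \<in> S)"
    using bipartiteE by blast
  have S12: "v1 \<in> S \<longleftrightarrow> v2 \<in> S" using S[OF eE(1) v1(1)] S[OF eE(3) v2(1)] by blast
  define ends' where "ends' = (\<lambda>e. map_prod (\<lambda>x. if x = v2 then v1 else x) (\<lambda>x. if x = v2 then v1 else x) (ends e))"
  define E' where "E' = {e\<in>E. \<not> endpoints ends e \<subseteq> {v, v1, v2}}"
  have other: "v \<notin> endpoints ends g \<and> \<not> endpoints ends g \<subseteq> {v1, v2}" if g: "g \<in> E" "g \<noteq> e1" "g \<noteq> e2" for g
  proof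
    show nv: "v \<notin> endpoints ends g"
    proof
      assume "v \<in> endpoints ends g"
      then have "g \<in> star E ends v" using g(1) by (simp add: in_star)
      then show False using e(1) g by simp
    qed
    show "\<not> endpoints ends g \<subseteq> {v1, v2}"
    proof
      assume "endpoints ends g \<subseteq> {v1, v2}"
      then have "fst (ends g) \<in> S \<longleftrightarrow> snd (ends g) \<in> S" using S12 by (auto simp: endpoints_def)
      then show False using S[OF g(1), of "fst (ends g)" "snd (ends g)"] by (simp add: endpoints_def)
    qed
  qed
  have E': "E' = E - {e1} - {e2}"
    using other v1(1) v2(1) unfolding E'_def by auto
  \<comment> \<open>The graph between the two contractions, with \<open>v\<close> merged into
    \<open>v1\<close>. It agrees with \<open>ends\<close> off \<open>e1\<close> and
    \<open>e2\<close>, since no other edge is at \<open>v\<close>, so merging \<open>v2\<close> next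
    gives \<open>ends'\<close>.\<close>
  define ends1 where "ends1 = (\<lambda>e. map_prod (\<lambda>x. if x = v then v1 else x) (\<lambda>x. if x = v then v1 else x) (ends e))"
  have ep1: "endpoints ends1 g = (\<lambda>x. if x = v then v1 else x) ` endpoints ends g" for g
    by (simp add: ends1_def endpoints_def)
  have same: "ends1 g = ends g" if "g \<in> E" "g \<noteq> e1" "g \<noteq> e2" for g
    using other[OF that] by (cases "ends g") (auto simp: ends1_def endpoints_def)
  have ep1': "endpoints ends1 g = endpoints ends g" if "g \<in> E" "g \<noteq> e1" "g \<noteq> e2" for g
    using same[OF that] by (simp add: endpoints_def)
  have e2': "endpoints ends1 e2 = {v1, v2}" unfolding ep1 v2(1) using v2(2) by auto
  have "odd_outer (E - {e1}) ends1 near f0"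
  proof (rule odd_outer_contract[OF oo eE(1)])
    show "endpoints ends e1 = {v1, v}" using v1(1) by auto
    show "v1 \<noteq> v" by (rule v1(2))
    show "\<not> endpoints ends g \<subseteq> {v1, v}" if g: "g \<in> E" "g \<noteq> e1" for g
    proof (cases "g = e2")
      case True
      then show ?thesis using v2 v12 by auto
    next
      case False
      then show ?thesis using other[OF g] by blast
    qed
  qed (use loop ep1 in auto)
  then have "odd_outer (E - {e1} - {e2}) ends' near f0"
  proof (rule odd_outer_contract)
    show "e2 \<in> E - {e1}" using eE e by simp
    show "endpoints ends1 e2 = {v1, v2}" by (rule e2')
    show "v1 \<noteq> v2" by (rule v12)
    show "\<not> endpoints ends1 g \<subseteq> {v1, v2}" if g: "g \<in> E - {e1}" "g \<noteq> e2" for g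
      using other[of g] ep1'[of g] g by simp
    show "fst (ends1 g) \<noteq> snd (ends1 g)" if g: "g \<in> E - {e1}" for g
    proof (cases "g = e2")
      case True
      then show ?thesis using e2' v12 by (auto simp: endpoints_def doubleton_eq_iff)
    next
      case False
      then show ?thesis using same[of g] loop[of g] g by simp
    qed
    show "endpoints ends' g = (\<lambda>x. if x = v2 then v1 else x) ` endpoints ends1 g" if g: "g \<in> E - {e1} - {e2}" for g
      using ep1'[of g] g by (simp add: ends'_def endpoints_def)
  qed
  then have oo': "odd_outer E' ends' near f0" by (simp add: E')
  have "v1 \<in> V" using inV[OF eE(1)] v1(1) by auto
  have "multigraph (V - {v, v2}) E' ends'"
    unfolding multigraph_def
  proof (intro conjI ballI)
    fix g assume "g \<in> E'"
    then have g: "g \<in> E" "g \<noteq> e1" "g \<noteq> e2" by (auto simp: E')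
    show "fst (ends' g) \<in> V - {v, v2}" "snd (ends' g) \<in> V - {v, v2}" "fst (ends' g) \<noteq> snd (ends' g)"
      using other[OF g] inV[OF g(1)] loop[OF g(1)] \<open>v1 \<in> V\<close> v1(2) v12
      by (auto simp: ends'_def endpoints_def)
  qed (use mg in \<open>auto simp: multigraph_def E'\<close>)
  moreover have "bipartite E' ends'"
    unfolding bipartite_def
  proof (intro exI ballI)
    fix g assume "g \<in> E'"
    then have "g \<in> E" by (simp add: E')
    from S[OF this, of "fst (ends g)" "snd (ends g)"]
    show "(fst (ends' g) \<in> S) \<noteq> (snd (ends' g) \<in> S)"
      using S12 by (auto simp: ends'_def endpoints_def)
  qed
  moreover have "move (V, E, ends) (V - {v, v2}, E', ends')"
  proof -
    have "v \<in> V" using inV[OF eE(1)] v1(1) by auto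
    then have "move_VC (V, E, ends) (V - {v, v2}, E', ends')"
      unfolding move_VC_def E'_def ends'_def prod.case
      by (intro exI[of _ v] exI[of _ v1] exI[of _ v2] exI[of _ e1] exI[of _ e2])
        (use v eE(1,3) e(2) v1 v2 v12 in simp)
    then show ?thesis by (simp add: move_def)
  qed
  moreover have "E' \<subset> E" using eE(1) by (auto simp: E')
  ultimately show ?thesis using oo' unfolding reduction_invariant_def by blast
qed

section \<open>Irreducible graphs have no edges\<close>

text \<open>A positive even degree is at least two, so an edge \<open>uv\<close> continues to
  \<open>vw\<close> and \<open>wx\<close>, and to \<open>uy\<close> at its other end. Simplicity
  excludes \<open>w = u\<close> and bipartiteness excludes the triangle \<open>x = u\<close>, which
  makes the four edges distinct.\<close>

lemma even_edges_card_ge_4: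
  assumes C: "finite C" "C \<noteq> {}" "even_edges ends C" and bip: "bipartite C ends"
    and inj: "inj_on (endpoints ends) C" and loop: "\<And>e. e \<in> C \<Longrightarrow> fst (ends e) \<noteq> snd (ends e)"
  shows "4 \<le> card C"
proof -
  have next_edge: "\<exists>h w. h \<in> C \<and> h \<noteq> g \<and> endpoints ends h = {v, w} \<and> w \<noteq> v" if g: "g \<in> C" "v \<in> endpoints ends g" for g v
  proof -
    have gs: "g \<in> star C ends v" using g by (simp add: in_star)
    have "star C ends v \<noteq> {g}" using even_edgesD[OF C(3), of v] by auto
    then obtain h where h: "h \<in> star C ends v" "h \<noteq> g" using gs by blast
    then have hC: "h \<in> C" "v \<in> endpoints ends h" by (auto simp: in_star)
    obtain w where "endpoints ends h = {v, w}" "w \<noteq> v" using loop[OF hC(1)] hC(2) by (rule other_endpoint)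
    then show ?thesis using hC(1) h(2) by blast
  qed
  obtain S where S: "\<And>e v w. e \<in> C \<Longrightarrow> endpoints ends e = {v, w} \<Longrightarrow> (v \<in> S) \<noteq> (w \<in> S)"
    using bipartiteE[OF bip] by blast
  obtain e where e: "e \<in> C" using C(2) by blast
  obtain u v where uv: "endpoints ends e = {u, v}" unfolding endpoints_def by blast
  obtain e2 w where e2: "e2 \<in> C" "e2 \<noteq> e" "endpoints ends e2 = {v, w}" "w \<noteq> v"
    using next_edge[OF e, of v] uv by auto
  obtain e3 x where e3: "e3 \<in> C" "e3 \<noteq> e2" "endpoints ends e3 = {w, x}" "x \<noteq> w"
    using next_edge[OF e2(1), of w] e2(3) by auto
  obtain e4 y where e4: "e4 \<in> C" "e4 \<noteq> e" "endpoints ends e4 = {u, y}" "y \<noteq> u"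
    using next_edge[OF e, of u] uv by auto
  have uvS: "(u \<in> S) \<noteq> (v \<in> S)" by (rule S[OF e uv])
  have vwS: "(v \<in> S) \<noteq> (w \<in> S)" by (rule S[OF e2(1,3)])
  have wxS: "(w \<in> S) \<noteq> (x \<in> S)" by (rule S[OF e3(1,3)])
  have "w \<noteq> u" using inj_onD[OF inj _ e2(1) e] e2 uv by auto
  moreover have "u \<noteq> v" using uvS by blast
  moreover have "u \<noteq> x" using uvS vwS wxS by blast
  ultimately have "u \<notin> {v, w}" "u \<notin> {w, x}" "w \<notin> {u, v}" using e2(4) by auto
  then have "e \<noteq> e3" "e4 \<noteq> e2" "e4 \<noteq> e3" using e2(3) e3(3) e4(3) uv by auto
  then have "card {e, e2, e3, e4} = 4" using e2(2) e3(2) e4(2) by auto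
  moreover have "{e, e2, e3, e4} \<subseteq> C" using e e2 e3 e4 by simp
  ultimately show ?thesis using card_mono[OF C(1), of "{e, e2, e3, e4}"] by simp
qed

text \<open>The map sending an edge set to its set of odd vertices has fibres of the size of the cycle
  space; by the handshake lemma, one vertex may be ignored.\<close>

lemma card_Pow_le_even_edges:
  fixes ends :: "'e \<Rightarrow> 'v \<times> 'v"
  assumes E: "finite E" and loop: "\<And>e. e \<in> E \<Longrightarrow> fst (ends e) \<noteq> snd (ends e)"
    and N: "finite N" "\<And>e. e \<in> E \<Longrightarrow> endpoints ends e \<subseteq> N" and v0: "v0 \<in> N"
  shows "2 ^ card E \<le> card {C. C \<subseteq> E \<and> even_edges ends C} * 2 ^ (card N - 1)"
proof -
  define odds where "odds C = {v\<in>N - {v0}. odd (degree C ends v)}" for C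
  define Z where "Z = {C. C \<subseteq> E \<and> even_edges ends C}"
  \<comment> \<open>One representative for each set of odd vertices. Adding it to \<open>C\<close>
    gives an even set, so \<open>C\<close> is encoded by an even set together with its odd
    vertices.\<close>
  define rep where "rep U = (SOME C. C \<subseteq> E \<and> odds C = U)" for U
  have rep: "rep (odds C) \<subseteq> E \<and> odds (rep (odds C)) = odds C" if "C \<subseteq> E" for C
    unfolding rep_def by (rule someI[of _ C]) (use that in simp)
  have fin: "finite C" if "C \<subseteq> E" for C using that E by (rule finite_subset)
  have deg0: "degree C ends v = 0" if "C \<subseteq> E" "v \<notin> N" for C v
  proof -
    have "star C ends v = {}" using that N(2) by (auto simp: star_def)
    then show ?thesis by (simp add: degree_eq_card_star)
  qed
  have handshake: "even_edges ends C" if C: "C \<subseteq> E" and ev: "\<And>v. v \<in> N - {v0} \<Longrightarrow> even (degree C ends v)" for C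
  proof -
    have "card (endpoints ends g \<inter> N) = 2" if "g \<in> C" for g
    proof -
      have "endpoints ends g \<inter> N = endpoints ends g" using N(2)[of g] that C by blast
      then show ?thesis using loop[of g] that C by (auto simp: endpoints_def)
    qed
    then have "(\<Sum>v\<in>N. degree C ends v) = 2 * card C" using sum_degree[OF N(1) fin[OF C], of ends] by simp
    \<comment> \<open>The degree sum is even, so \<open>v0\<close> inherits evenness from the other
      vertices; this is the \<open>- 1\<close> in the exponent.\<close>
    then have "even (degree C ends v0 + (\<Sum>v\<in>N - {v0}. degree C ends v))"
      using sum.remove[OF N(1) v0, of "degree C ends"] by simp
    moreover have "even (\<Sum>v\<in>N - {v0}. degree C ends v)" using ev by (rule dvd_sum)
    ultimately have "even (degree C ends v0)" by simp
    then have "even (degree C ends v)" for v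
      using ev[of v] deg0[OF C, of v] by (cases "v \<in> N"; cases "v = v0") auto
    then show ?thesis by (simp add: even_edges_def)
  qed
  define F where "F C = (sym_diff C (rep (odds C)), odds C)" for C
  have "inj_on F (Pow E)"
  proof (rule inj_onI)
    fix C D assume "F C = F D"
    then have o: "odds C = odds D" and "sym_diff C (rep (odds C)) = sym_diff D (rep (odds C))"
      by (auto simp: F_def)
    then show "C = D" by blast
  qed
  moreover have "F ` Pow E \<subseteq> Z \<times> Pow (N - {v0})"
  proof
    fix p assume "p \<in> F ` Pow E"
    then obtain C where C: "C \<subseteq> E" and p: "p = F C" by auto
    have R: "rep (odds C) \<subseteq> E" "odds (rep (odds C)) = odds C" using rep[OF C] by auto
    have sub: "sym_diff C (rep (odds C)) \<subseteq> E" using C R(1) by blast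
    moreover have "even_edges ends (sym_diff C (rep (odds C)))"
    proof (rule handshake[OF sub])
      fix v assume v: "v \<in> N - {v0}"
      have "odd (degree C ends v) \<longleftrightarrow> odd (degree (rep (odds C)) ends v)"
        using v R(2) unfolding odds_def by blast
      then show "even (degree (sym_diff C (rep (odds C))) ends v)"
        by (simp only: even_degree_sym_diff[OF fin[OF C] fin[OF R(1)]]) blast
    qed
    ultimately have "sym_diff C (rep (odds C)) \<in> Z" by (simp add: Z_def)
    moreover have "odds C \<in> Pow (N - {v0})" by (auto simp: odds_def)
    ultimately show "p \<in> Z \<times> Pow (N - {v0})" unfolding p F_def by blast
  qed
  moreover have "finite (Z \<times> Pow (N - {v0}))"
    using E N(1) by (auto simp: Z_def intro: finite_subset[of _ "Pow E"])
  ultimately have "card (Pow E) \<le> card (Z \<times> Pow (N - {v0}))" by (rule card_inj_on_le)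
  then show ?thesis using E N(1) v0 by (simp add: card_cartesian_product card_Pow Z_def)
qed

text \<open>Two distinct faces beside an edge both belong to \<open>F1\<close>, so other faces do
  not influence the cut. A set and its complement have the same cut, so \<open>f1\<close> may be
  assumed to be left out.\<close>

lemma card_dual_cuts:
  assumes near: "\<And>e. e \<in> E \<Longrightarrow> \<exists>a b. near e \<subseteq> {a, b}"
    and F1: "F1 = {f. dual_cut E near {f} \<noteq> {}}" "finite F1"
    and f1: "f1 \<in> F1 \<or> F1 = {}"
  shows "card (range (dual_cut E near)) \<le> 2 ^ card (F1 - {f1})"
proof -
  have "dual_cut E near X \<in> dual_cut E near ` Pow (F1 - {f1})" for X
  proof -
    define Y where "Y = (if f1 \<in> X then F1 - X else F1 \<inter> X)"
    have "Y \<subseteq> F1 - {f1}" using f1 by (auto simp: Y_def)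
    moreover have "splits X (near e) \<longleftrightarrow> splits Y (near e)" if e: "e \<in> E" for e
    proof -
      obtain a b where ab: "near e \<subseteq> {a, b}" using near[OF e] by blast
      show ?thesis
      proof (cases "near e = {a, b} \<and> a \<noteq> b")
        case True
        then have "e \<in> dual_cut E near {a}" "e \<in> dual_cut E near {b}" using e by (auto simp: dual_cut_def splits_def)
        then have "a \<in> F1" "b \<in> F1" using F1(1) by auto
        then show ?thesis using True by (auto simp: splits_def Y_def)
      next
        case False
        then have "near e = {} \<or> (\<exists>c. near e = {c})" using ab by blast
        then show ?thesis by (auto simp: splits_def)
      qed
    qed
    then have "dual_cut E near X = dual_cut E near Y" by (auto simp: dual_cut_def)
    ultimately show ?thesis by blast
  qed
  then have "range (dual_cut E near) \<subseteq> dual_cut E near ` Pow (F1 - {f1})" by blast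
  then have "card (range (dual_cut E near)) \<le> card (Pow (F1 - {f1}))"
    using F1(2) by (intro surj_card_le) auto
  then show ?thesis using F1(2) by (simp add: card_Pow)
qed

lemma sum_swap_card:
  assumes "finite A" "finite B"
  shows "(\<Sum>a\<in>A. card {b\<in>B. R a b}) = (\<Sum>b\<in>B. card {a\<in>A. R a b})"
  using assms by (intro sum_multicount_gen) auto

text \<open>Euler's inequality against the degree count: bounded faces have at least four sides, and
  every external vertex accounts for two sides at the outer face.\<close>

lemma irreducible_impossible:
  fixes near :: "'e \<Rightarrow> 'f set"
  assumes oo: "odd_outer E ends near f0" and bip: "bipartite E ends" and E: "E \<noteq> {}"
    and loop: "\<And>e. e \<in> E \<Longrightarrow> fst (ends e) \<noteq> snd (ends e)"
    and inj: "inj_on (endpoints ends) E"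
    and deg: "\<And>v. degree E ends v = 0 \<or> 3 \<le> degree E ends v"
  shows False
proof -
  have fs: "face_structure E ends near" using oo by (simp add: odd_outer_def)
  note D = face_structureD[OF fs]
  have finE: "finite E" by (rule D(1))
  define N where "N = \<Union>(endpoints ends ` E)"
  have finN: "finite N" using finE by (simp add: N_def endpoints_def)
  have epN: "endpoints ends e \<subseteq> N" if "e \<in> E" for e using that by (auto simp: N_def)
  obtain v0 where v0: "v0 \<in> N" using E by (auto simp: N_def endpoints_def)
  have starN: "star E ends v \<noteq> {}" if "v \<in> N" for v using that by (auto simp: N_def star_def)
  have finite_near: "finite (near e)" if "e \<in> E" for e
    using D(2)[OF that] by (auto intro: finite_subset)
  define F1 where "F1 = {f. dual_cut E near {f} \<noteq> {}}"
  have "F1 \<subseteq> \<Union>(near ` E)" by (auto simp: F1_def dual_cut_def splits_def)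
  then have finF1: "finite F1" using finE finite_near by (auto intro: finite_subset)
  \<comment> \<open>Take \<open>f0\<close> if it is in \<open>F1\<close>, otherwise any member:
    \<open>F\<close> then never contains the outer face.\<close>
  obtain f1 where f1: "f1 \<in> F1 \<or> F1 = {}" "f0 \<notin> F1 - {f1}" by blast
  define F where "F = F1 - {f1}"
  have finF: "finite F" using finF1 by (simp add: F_def)
  have "dual_cut E near X \<subseteq> E" for X by (auto simp: dual_cut_def)
  then have "{C. C \<subseteq> E \<and> even_edges ends C} = range (dual_cut E near)"
    using D(3,4) by blast
  \<comment> \<open>Bounding the same family from below as a cycle space and from above as a cut
    space leaves Euler's inequality in the exponents.\<close>
  then have "2 ^ card E \<le> card (range (dual_cut E near)) * 2 ^ (card N - 1)"
    using card_Pow_le_even_edges[OF finE loop finN epN v0] by simp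
  also have "\<dots> \<le> 2 ^ card F * 2 ^ (card N - 1)"
    using card_dual_cuts[OF D(2) F1_def finF1 f1(1)] by (simp add: F_def)
  finally have "(2::nat) ^ card E \<le> 2 ^ (card F + (card N - 1))" by (simp add: power_add)
  then have "card E \<le> card F + (card N - 1)" by simp
  moreover have "card N > 0" using finN v0 by (auto simp: card_gt_0_iff)
  ultimately have euler: "card E + 1 \<le> card F + card N" by linarith
  \<comment> \<open>An edge with a single face beside it gets 0, since nothing splits it. So
    \<open>2 - sides g\<close> counts the sides of \<open>g\<close> not charged to a face in
    \<open>F\<close>.\<close>
  define sides where "sides g = card {f\<in>F. splits {f} (near g)}" for g
  have sides_near: "sides g \<le> card (near g - {f0})" if "g \<in> E" for g
    unfolding sides_def using finite_near[OF that] f1(2)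
    by (intro card_mono) (auto simp: splits_def F_def)
  have card_near: "card (near g) \<le> 2" if "g \<in> E" for g
  proof -
    obtain a b where "near g \<subseteq> {a, b}" using D(2)[OF \<open>g \<in> E\<close>] by blast
    then show ?thesis using card_mono[of "{a, b}" "near g"] by (auto simp: card_insert_if split: if_splits)
  qed
  have sides2: "sides g \<le> 2" if "g \<in> E" for g
    using sides_near[OF that] card_near[OF that] card_mono[OF finite_near[OF that], of "near g - {f0}"] by auto
  have sides1: "sides g \<le> 1" if "g \<in> E" "f0 \<in> near g" for g
    using sides_near[OF that(1)] card_near[OF that(1)] finite_near[OF that(1)] that(2) by simp
  have "4 * card F = (\<Sum>f\<in>F. 4)" by simp
  also have "\<dots> \<le> (\<Sum>f\<in>F. card (dual_cut E near {f}))"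
  proof (rule sum_mono)
    fix f assume "f \<in> F"
    have sub: "dual_cut E near {f} \<subseteq> E" by (auto simp: dual_cut_def)
    show "4 \<le> card (dual_cut E near {f})"
    proof (rule even_edges_card_ge_4)
      show "finite (dual_cut E near {f})" using sub finE by (rule finite_subset)
      show "dual_cut E near {f} \<noteq> {}" using \<open>f \<in> F\<close> by (simp add: F_def F1_def)
      show "even_edges ends (dual_cut E near {f})" by (rule D(4))
      show "bipartite (dual_cut E near {f}) ends" using bip sub by (rule bipartite_mono)
      show "inj_on (endpoints ends) (dual_cut E near {f})" using inj sub by (rule inj_on_subset)
      show "fst (ends e) \<noteq> snd (ends e)" if "e \<in> dual_cut E near {f}" for e using loop that sub by blast
    qed
  qed
  also have "\<dots> = (\<Sum>g\<in>E. sides g)"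
    unfolding dual_cut_def sides_def using finF finE by (rule sum_swap_card)
  finally have faces: "4 * card F \<le> (\<Sum>g\<in>E. sides g)" .
  define X where "X = {v\<in>N. outer_vertex E ends near f0 v}"
  have outer: "2 \<le> (\<Sum>g\<in>star E ends v. 2 - sides g)" if v: "v \<in> X" for v
  proof -
    have starE: "star E ends v \<subseteq> E" by (auto simp: star_def)
    have fin: "finite (star E ends v)" using finE by (rule finite_star)
    obtain g where g: "g \<in> star E ends v" "f0 \<in> near g"
      using v starN[of v] by (auto simp: X_def outer_vertex_def)
    \<comment> \<open>If \<open>f0\<close> is alone beside \<open>g\<close>, both sides of
      \<open>g\<close> count. Otherwise the cut of \<open>{f0}\<close> is even at \<open>v\<close>
      and supplies a second edge, and each of the two contributes one side.\<close>
    show ?thesis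
    proof (cases "splits {f0} (near g)")
      case False
      then have "near g = {f0}" using g(2) unfolding splits_def by blast
      moreover have "g \<in> E" using g(1) starE by blast
      ultimately have "sides g = 0" using sides_near[of g] by simp
      then show ?thesis using member_le_sum[of g "star E ends v" "\<lambda>g. 2 - sides g"] g(1) fin by simp
    next
      case True
      have "{g\<in>star E ends v. splits {f0} (near g)} \<noteq> {g}" by (rule face_structure_cut_not_single[OF fs])
      then obtain h where h: "h \<in> star E ends v" "splits {f0} (near h)" "h \<noteq> g" using True g(1) by blast
      then have "f0 \<in> near h" by (auto simp: splits_def)
      then have "1 \<le> 2 - sides g" "1 \<le> 2 - sides h"
        using sides1[of g] sides1[of h] g h(1) starE by force+
      moreover have "(\<Sum>g\<in>{g, h}. 2 - sides g) \<le> (\<Sum>g\<in>star E ends v. 2 - sides g)"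
        using g(1) h(1) fin by (intro sum_mono2) auto
      ultimately show ?thesis using h(3) by simp
    qed
  qed
  have ep2: "card (endpoints ends g \<inter> N) = 2" if "g \<in> E" for g
  proof -
    have "endpoints ends g \<inter> N = endpoints ends g" using epN[OF that] by blast
    then show ?thesis using loop[OF that] by (simp add: endpoints_def)
  qed
  \<comment> \<open>Each edge is counted at both of its ends, so the factor 2 cancels.\<close>
  have "2 * card X = (\<Sum>v\<in>X. 2)" by simp
  also have "\<dots> \<le> (\<Sum>v\<in>X. \<Sum>g\<in>star E ends v. 2 - sides g)" by (rule sum_mono) (rule outer)
  also have "\<dots> \<le> (\<Sum>v\<in>N. \<Sum>g\<in>star E ends v. 2 - sides g)"
    using finN by (intro sum_mono2) (auto simp: X_def)
  also have "\<dots> = (\<Sum>v\<in>N. \<Sum>g\<in>E. if v \<in> endpoints ends g then 2 - sides g else 0)"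
    using finE by (simp add: star_def sum.inter_filter)
  also have "\<dots> = (\<Sum>g\<in>E. \<Sum>v\<in>N. if v \<in> endpoints ends g then 2 - sides g else 0)"
    by (rule sum.swap)
  also have "\<dots> = (\<Sum>g\<in>E. 2 * (2 - sides g))"
  proof (rule sum.cong[OF refl])
    fix g assume g: "g \<in> E"
    have "(\<Sum>v\<in>N. if v \<in> endpoints ends g then 2 - sides g else 0) = (\<Sum>v\<in>N \<inter> endpoints ends g. 2 - sides g)"
      by (rule sum.inter_restrict[OF finN, symmetric])
    then show "(\<Sum>v\<in>N. if v \<in> endpoints ends g then 2 - sides g else 0) = 2 * (2 - sides g)"
      using ep2[OF g] by (simp add: Int_commute)
  qed
  also have "\<dots> = 2 * (\<Sum>g\<in>E. 2 - sides g)" by (rule sum_distrib_left[symmetric])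
  finally have "card X \<le> (\<Sum>g\<in>E. 2 - sides g)" by simp
  moreover have "(\<Sum>g\<in>E. 2 - sides g) + (\<Sum>g\<in>E. sides g) = 2 * card E"
    using sides2 by (simp flip: sum.distrib)
  ultimately have sides: "4 * card F + card X \<le> 2 * card E" using faces by linarith
  have degs: "4 \<le> degree E ends v + (if v \<in> X then 1 else 0)" if v: "v \<in> N" for v
  proof -
    have "degree E ends v \<noteq> 0" using starN[OF v] finE by (simp add: degree_eq_card_star finite_star)
    then have d: "3 \<le> degree E ends v" using deg[of v] by linarith
    show ?thesis
    proof (cases "v \<in> X")
      case False
      then have "even (degree E ends v)" using oo v by (auto simp: odd_outer_def X_def)
      then have "degree E ends v \<noteq> 3" by auto
      then show ?thesis using d by simp
    qed (use d in simp)
  qed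
  have "4 * card N = (\<Sum>v\<in>N. 4)" by simp
  also have "\<dots> \<le> (\<Sum>v\<in>N. degree E ends v + (if v \<in> X then 1 else 0))" by (rule sum_mono) (rule degs)
  also have "\<dots> = (\<Sum>v\<in>N. degree E ends v) + card X"
  proof -
    have "N \<inter> X = X" by (auto simp: X_def)
    then have "(\<Sum>v\<in>N. if v \<in> X then 1 else 0) = card X"
      using sum.inter_restrict[OF finN, of "\<lambda>_. 1 :: nat" X] by simp
    then show ?thesis by (simp add: sum.distrib)
  qed
  also have "(\<Sum>v\<in>N. degree E ends v) = 2 * card E"
    using sum_degree[OF finN finE, of ends] ep2 by simp
  \<comment> \<open>Adding \<open>4 * card N \<le> 2 * card E + card X\<close> to
    \<open>sides\<close> cancels \<open>card X\<close> and leaves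
    \<open>card F + card N \<le> card E\<close>, against \<open>euler\<close>.\<close>
  finally show False using euler sides by linarith
qed

section \<open>Induction over the moves\<close>

text \<open>Parallel edges go first, since both the treatment of degree 2 and the final count
  presuppose a simple graph.\<close>

lemma reduction_step:
  fixes near :: "'e \<Rightarrow> 'f set"
  assumes inv: "reduction_invariant V E ends near f0" and E: "E \<noteq> {}"
  shows "\<exists>V' E' ends' (near' :: 'e \<Rightarrow> 'f set). move (V, E, ends) (V', E', ends') \<and>
    reduction_invariant V' E' ends' near' f0 \<and> E' \<subset> E"
proof (cases "inj_on (endpoints ends) E")
  case False
  then obtain e1 e2 where "e1 \<in> E" "e2 \<in> E" "e1 \<noteq> e2" "endpoints ends e1 = endpoints ends e2"
    by (auto simp: inj_on_def)
  then show ?thesis by (rule reduce_parallel[OF inv])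
next
  case inj: True
  have "\<exists>v. degree E ends v = 1 \<or> degree E ends v = 2"
  proof (rule ccontr)
    assume no: "\<not> ?thesis"
    have "degree E ends v = 0 \<or> 3 \<le> degree E ends v" for v
    proof -
      have "degree E ends v \<noteq> 1" "degree E ends v \<noteq> 2" using no by blast+
      then show ?thesis by linarith
    qed
    then show False
      using irreducible_impossible[of E ends near f0] inv E inj
      by (auto simp: reduction_invariant_def multigraph_def)
  qed
  then obtain v where "degree E ends v = 1 \<or> degree E ends v = 2" by blast
  then show ?thesis using reduce_leaf[OF inv] reduce_degree_two[OF inv _ inj] by blast
qed

lemma reduction_invariant_reducible:
  fixes near :: "'e \<Rightarrow> 'f set"
  assumes "reduction_invariant V E ends near f0"
  shows "reducible (V, E, ends)"
  using assms
proof (induction "card E" arbitrary: V E ends near rule: less_induct)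
  case less
  show ?case
  proof (cases "E = {}")
    case True
    then show ?thesis unfolding reducible_def by blast
  next
    case False
    then obtain V' E' ends' and near' :: "'e \<Rightarrow> 'f set" where
      m: "move (V, E, ends) (V', E', ends')" "reduction_invariant V' E' ends' near' f0" "E' \<subset> E"
      using reduction_step[OF less.prems] by blast
    have "finite E" using less.prems by (simp add: reduction_invariant_def multigraph_def)
    then have "card E' < card E" using m(3) by (rule psubset_card_mono)
    then have "reducible (V', E', ends')" using m(2) by (rule less.hyps)
    then show ?thesis
      unfolding reducible_def by (meson m(1) converse_rtranclp_into_rtranclp)
  qed
qed

section \<open>Faces of plane graphs\<close>

text \<open>A path is recorded by its vertex set and its edge set, because only the parities of its
  degrees and the union of its arcs are used; the freshness of \<open>c\<close> keeps it
  simple.\<close>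

inductive simple_walk :: "'e set \<Rightarrow> ('e \<Rightarrow> 'v \<times> 'v) \<Rightarrow> 'v \<Rightarrow> 'v \<Rightarrow> 'v set \<Rightarrow> 'e set \<Rightarrow> bool"
  for E ends u where
  nil: "simple_walk E ends u u {u} {}"
| snoc: "simple_walk E ends u b S Q \<Longrightarrow> g \<in> E \<Longrightarrow> endpoints ends g = {b, c} \<Longrightarrow> c \<notin> S
    \<Longrightarrow> simple_walk E ends u c (insert c S) (insert g Q)"

lemma simple_walk_basic:
  assumes "simple_walk E ends u b S Q"
  shows "u \<in> S" "b \<in> S" "Q \<subseteq> E" "finite Q" "\<And>q. q \<in> Q \<Longrightarrow> endpoints ends q \<subseteq> S"
  using assms by (induction) auto

text \<open>Makes the vertices reachable by simple walks closed under adjacency: a neighbour already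
  visited is reached by a prefix.\<close>

lemma simple_walk_prefix:
  assumes "simple_walk E ends u b S Q" "x \<in> S"
  shows "\<exists>S' Q'. simple_walk E ends u x S' Q'"
  using assms by (induction) (auto intro: simple_walk.intros)

lemma simple_walk_degree:
  assumes "simple_walk E ends u b S Q"
  shows "odd (degree Q ends v) \<longleftrightarrow> (v = u) \<noteq> (v = b)"
  using assms
proof (induction)
  case nil
  then show ?case by (simp add: degree_def)
next
  case (snoc b S Q g c)
  have "g \<notin> Q" "b \<in> S" "u \<in> S" using simple_walk_basic[OF snoc.hyps(1)] snoc.hyps by blast+
  then show ?case
    using snoc simple_walk_basic(4)[OF snoc.hyps(1)] by (auto simp: degree_insert)
qed

section \<open>Drawings and their complements\<close>

locale plane_graph =
  fixes V :: "'v set" and E :: "'e set" and ends :: "'e \<Rightarrow> 'v \<times> 'v"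
    and pos :: "'v \<Rightarrow> complex" and \<gamma> :: "'e \<Rightarrow> real \<Rightarrow> complex"
  assumes multigraph: "multigraph V E ends"
    and embedding: "plane_embedding V E ends pos \<gamma>"
begin

text \<open>All vertices are kept, also isolated ones, so that an induction over the edges stays
  within plane graphs on \<open>V\<close>.\<close>

lemma remove_edges: "F \<subseteq> E \<Longrightarrow> plane_graph V F ends pos \<gamma>"
  using multigraph embedding finite_subset[of F E]
  unfolding plane_graph_def multigraph_def plane_embedding_def by (simp add: subset_eq)

lemma finite_VE: "finite V" "finite E"
  using multigraph by (auto simp: multigraph_def)

lemma endpoints_edge:
  assumes "e \<in> E"
  obtains u w where "endpoints ends e = {u, w}" "u \<noteq> w" "u \<in> V" "w \<in> V"
    "pathstart (\<gamma> e) = pos u" "pathfinish (\<gamma> e) = pos w"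
  using assms multigraph embedding
  by (auto simp: multigraph_def plane_embedding_def endpoints_def)

lemma arc_edge: "e \<in> E \<Longrightarrow> arc (\<gamma> e)"
  using embedding by (auto simp: plane_embedding_def)

lemma pos_eq: "u \<in> V \<Longrightarrow> w \<in> V \<Longrightarrow> pos u = pos w \<longleftrightarrow> u = w"
  using embedding by (auto simp: plane_embedding_def inj_on_def)

lemma edge_vertices: "e \<in> E \<Longrightarrow> path_image (\<gamma> e) \<inter> pos ` V \<subseteq> pos ` endpoints ends e"
  using embedding by (auto simp: plane_embedding_def)

lemma edges_meet:
  "e \<in> E \<Longrightarrow> g \<in> E \<Longrightarrow> e \<noteq> g \<Longrightarrow>
    path_image (\<gamma> e) \<inter> path_image (\<gamma> g) \<subseteq> pos ` (endpoints ends e \<inter> endpoints ends g)"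
  using embedding unfolding plane_embedding_def by blast

definition open_arc :: "'e \<Rightarrow> complex set" where
  "open_arc e = path_image (\<gamma> e) - pos ` endpoints ends e"

abbreviation draw :: "'e set \<Rightarrow> complex set" where
  "draw F \<equiv> drawing V F pos \<gamma>"

lemma pos_endpoints_path_image: "e \<in> E \<Longrightarrow> pos ` endpoints ends e \<subseteq> path_image (\<gamma> e)"
  by (erule endpoints_edge) (auto intro: pathstart_in_path_image pathfinish_in_path_image
    simp: pathstart_in_path_image pathfinish_in_path_image dest: sym)

lemma open_arc_endless: "e \<in> E \<Longrightarrow> open_arc e = path_image (\<gamma> e) - {pathstart (\<gamma> e), pathfinish (\<gamma> e)}"
  unfolding open_arc_def by (erule endpoints_edge) simp

lemma connected_open_arc: "e \<in> E \<Longrightarrow> connected (open_arc e)"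
  using connected_simple_path_endless[OF arc_imp_simple_path[OF arc_edge]] by (simp add: open_arc_endless)

lemma midpoint_open_arc: assumes "e \<in> E" shows "\<gamma> e (1/2) \<in> open_arc e"
proof -
  have "\<gamma> e (1/2) \<noteq> \<gamma> e 0" "\<gamma> e (1/2) \<noteq> \<gamma> e 1"
    using arc_edge[OF assms] inj_onD[of "\<gamma> e" "{0..1}" "1/2" 0] inj_onD[of "\<gamma> e" "{0..1}" "1/2" 1]
    by (auto simp: arc_def)
  then show ?thesis
    using assms by (auto simp: open_arc_endless path_image_def pathstart_def pathfinish_def)
qed

lemma compact_draw: "F \<subseteq> E \<Longrightarrow> compact (draw F)"
  unfolding drawing_def using finite_VE arc_edge
  by (auto intro!: compact_Un compact_UN intro: finite_imp_compact finite_subset compact_arc_image)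

lemma draw_mono: "F \<subseteq> F' \<Longrightarrow> draw F \<subseteq> draw F'"
  by (auto simp: drawing_def)

lemma draw_remove:
  assumes "F \<subseteq> E" "e \<in> F"
  shows "draw F = open_arc e \<union> draw (F - {e})"
proof -
  have "e \<in> E" using assms by blast
  then have "pos ` endpoints ends e \<subseteq> pos ` V"
    by (rule endpoints_edge) auto
  then show ?thesis using assms unfolding drawing_def open_arc_def by blast
qed

lemma open_arc_disjoint:
  assumes "F \<subseteq> E" "e \<in> E"
  shows "open_arc e \<inter> draw (F - {e}) = {}"
proof -
  have "open_arc e \<inter> pos ` V = {}" using edge_vertices[OF assms(2)] unfolding open_arc_def by blast
  moreover have "open_arc e \<inter> path_image (\<gamma> g) = {}" if "g \<in> F - {e}" for g
    using edges_meet[OF assms(2), of g] that assms unfolding open_arc_def by blast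
  ultimately show ?thesis unfolding drawing_def by blast
qed

section \<open>Faces beside an edge\<close>

definition faces :: "complex set set" where
  "faces = components (- draw E)"

text \<open>The two sides of an edge, merged by erasing the edge.\<close>

definition region :: "'e \<Rightarrow> complex set" where
  "region e = connected_component_set (- draw (E - {e})) (\<gamma> e (1/2))"

text \<open>Inclusion in \<open>region e\<close> avoids any local analysis along the arc; that at
  most two faces qualify comes later from theorems on plane separation.\<close>

definition near :: "'e \<Rightarrow> complex set set" where
  "near e = {f\<in>faces. f \<subseteq> region e}"

lemma open_compl_draw: "F \<subseteq> E \<Longrightarrow> open (- draw F)"
  using compact_draw compact_imp_closed by blast

lemma face_props:
  assumes "f \<in> faces"
  shows "open f" "connected f" "f \<noteq> {}" "f \<inter> draw E = {}"
  using assms open_components[OF open_compl_draw[OF order_refl], of f]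
    in_components_connected[of f] in_components_nonempty[of f] in_components_subset[of f]
  unfolding faces_def by blast+

lemma face_maximal:
  "f \<in> faces \<Longrightarrow> connected T \<Longrightarrow> T \<inter> draw E = {} \<Longrightarrow> f \<inter> T \<noteq> {} \<Longrightarrow> T \<subseteq> f"
  unfolding faces_def using components_maximal[of f "- draw E" T] by blast

lemma faces_eq: "f \<in> faces \<Longrightarrow> g \<in> faces \<Longrightarrow> x \<in> f \<Longrightarrow> x \<in> g \<Longrightarrow> f = g"
  unfolding faces_def using components_nonoverlap[of f _ g] by blast

lemma face_through:
  assumes "x \<notin> draw E" obtains f where "f \<in> faces" "x \<in> f"
  using assms that[of "connected_component_set (- draw E) x"] unfolding faces_def
  by (simp add: componentsI)

lemma region_in_components: "e \<in> E \<Longrightarrow> region e \<in> components (- draw (E - {e}))"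
  unfolding region_def using midpoint_open_arc[of e] open_arc_disjoint[OF order_refl, of e]
  by (intro componentsI) blast

lemma region_props:
  assumes "e \<in> E"
  shows "open (region e)" "connected (region e)" "open_arc e \<subseteq> region e" "region e \<inter> draw (E - {e}) = {}"
proof -
  note c = region_in_components[OF assms]
  show "open (region e)" using c open_components[OF open_compl_draw] by blast
  show "connected (region e)" using c in_components_connected by blast
  show "region e \<inter> draw (E - {e}) = {}" using in_components_subset[OF c] by blast
  have "\<gamma> e (1/2) \<notin> draw (E - {e})"
    using midpoint_open_arc[OF assms] open_arc_disjoint[OF order_refl assms] by blast
  then have "\<gamma> e (1/2) \<in> region e"
    unfolding region_def by (simp add: connected_component_refl)
  then show "open_arc e \<subseteq> region e"
    using components_maximal[OF c connected_open_arc[OF assms]] open_arc_disjoint[OF order_refl assms]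
      midpoint_open_arc[OF assms] by blast
qed

lemma region_maximal:
  "e \<in> E \<Longrightarrow> connected T \<Longrightarrow> T \<inter> draw (E - {e}) = {} \<Longrightarrow> region e \<inter> T \<noteq> {} \<Longrightarrow> T \<subseteq> region e"
  using components_maximal[OF region_in_components, of e T] by blast

lemma face_meets_region:
  assumes "e \<in> E" "f \<in> faces" "f \<inter> region e \<noteq> {}"
  shows "f \<in> near e"
proof -
  have "f \<subseteq> region e"
    using region_maximal[OF assms(1), of f] face_props[OF assms(2)] draw_mono[of "E - {e}" E] assms(3) by blast
  then show ?thesis using assms by (simp add: near_def)
qed

lemma region_eq:
  assumes "e \<in> E"
  shows "region e = open_arc e \<union> \<Union>(near e)"
proof
  show "open_arc e \<union> \<Union>(near e) \<subseteq> region e"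
    using region_props(3)[OF assms] by (auto simp: near_def)
  show "region e \<subseteq> open_arc e \<union> \<Union>(near e)"
  proof
    fix x assume x: "x \<in> region e"
    show "x \<in> open_arc e \<union> \<Union>(near e)"
    proof (cases "x \<in> draw E")
      case True
      then have "x \<in> open_arc e" using x region_props(4)[OF assms] draw_remove[OF order_refl assms] by auto
      then show ?thesis by blast
    next
      case False
      then obtain f where "f \<in> faces" "x \<in> f" by (rule face_through)
      then show ?thesis using face_meets_region[OF assms] x by blast
    qed
  qed
qed

text \<open>The region is connected and made of the open arc and disjoint open faces. A face whose
  closure missed the arc would be open and closed in it.\<close>

lemma near_touches:
  assumes e: "e \<in> E" and f: "f \<in> near e"
  shows "closure f \<inter> open_arc e \<noteq> {}"
proof
  assume no: "closure f \<inter> open_arc e = {}"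
  have ff: "f \<in> faces" "f \<subseteq> region e" using f by (auto simp: near_def)
  have "region e \<subseteq> f \<union> - closure f"
  proof
    fix x assume x: "x \<in> region e"
    show "x \<in> f \<union> - closure f"
    proof (rule ccontr)
      assume "x \<notin> f \<union> - closure f"
      then have "x \<in> closure f" "x \<notin> f" by auto
      then have "x \<in> \<Union>(near e)" using x no region_eq[OF e] by blast
      then obtain g where g: "g \<in> faces" "x \<in> g" by (auto simp: near_def)
      then have "g \<inter> f \<noteq> {}"
        using \<open>x \<in> closure f\<close> open_Int_closure_eq_empty[OF face_props(1)[OF g(1)], of f] by blast
      then show False using faces_eq[of g f] g ff \<open>x \<notin> f\<close> by blast
    qed
  qed
  moreover have "f \<inter> region e \<noteq> {}" using ff face_props(3)[of f] by blast
  moreover have "- closure f \<inter> region e \<noteq> {}"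
  proof -
    have "\<gamma> e (1/2) \<in> - closure f" "\<gamma> e (1/2) \<in> region e"
      using no midpoint_open_arc[OF e] region_props(3)[OF e] by auto
    then show ?thesis by blast
  qed
  moreover have "f \<inter> - closure f \<inter> region e = {}" using closure_subset[of f] by auto
  moreover have "open (- closure f)" by (simp add: open_Compl)
  ultimately show False
    using connectedD[OF region_props(2)[OF e] face_props(1)[OF ff(1)]] by metis
qed

section \<open>Cycles, bridges and plane separation\<close>

lemma oriented_edge:
  assumes "e \<in> E" "endpoints ends e = {b, c}"
  obtains g where "arc g" "pathstart g = pos b" "pathfinish g = pos c" "path_image g = path_image (\<gamma> e)"
proof -
  obtain u w where uw: "endpoints ends e = {u, w}" "u \<noteq> w" "u \<in> V" "w \<in> V"
    "pathstart (\<gamma> e) = pos u" "pathfinish (\<gamma> e) = pos w" using endpoints_edge[OF assms(1)] .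
  then have "u = b \<and> w = c \<or> u = c \<and> w = b" using assms(2) by (auto simp: doubleton_eq_iff)
  then show thesis
    using that[of "\<gamma> e"] that[of "reversepath (\<gamma> e)"] uw arc_edge[OF assms(1)]
    by (auto simp: arc_reversepath)
qed

text \<open>The new arc meets the old ones only at \<open>pos b\<close>, because the edges in
  \<open>Q\<close> end in \<open>S\<close> and \<open>c\<close> is outside \<open>S\<close>. The
  empty walk is excluded, as a point is no arc.\<close>

lemma simple_walk_arc:
  assumes "simple_walk F ends u b S Q" "F \<subseteq> E" "b \<noteq> u"
  shows "\<exists>g. arc g \<and> pathstart g = pos u \<and> pathfinish g = pos b \<and>
    path_image g = (\<Union>q\<in>Q. path_image (\<gamma> q))"
  using assms
proof (induction)
  case (snoc b S Q g c)
  have gE: "g \<in> E" using snoc by auto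
  obtain h where h: "arc h" "pathstart h = pos b" "pathfinish h = pos c" "path_image h = path_image (\<gamma> g)"
    using oriented_edge[OF gE snoc.hyps(3)] .
  note w = simple_walk_basic[OF snoc.hyps(1)]
  show ?case
  proof (cases "b = u")
    case True
    from snoc.hyps(1) have "Q = {}"
    proof cases
      case (snoc b' S' Q' g')
      then show ?thesis using simple_walk_basic(1)[OF snoc(3)] True by auto
    qed simp
    then show ?thesis using h True by auto
  next
    case False
    then obtain k where k: "arc k" "pathstart k = pos u" "pathfinish k = pos b"
      "path_image k = (\<Union>q\<in>Q. path_image (\<gamma> q))" using snoc by auto
    have "path_image (\<gamma> q) \<inter> path_image (\<gamma> g) \<subseteq> {pos b}" if "q \<in> Q" for q
    proof -
      have qS: "endpoints ends q \<subseteq> S" using w(5) that by blast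
      moreover have "q \<in> E" using that w(3) snoc.prems(1) by blast
      moreover have "q \<noteq> g" using qS snoc.hyps(3,4) by auto
      ultimately have "q \<in> E" "q \<noteq> g" "endpoints ends q \<subseteq> S" by blast+
      then have "endpoints ends q \<inter> endpoints ends g \<subseteq> {b}" using snoc.hyps by auto
      then show ?thesis using edges_meet[OF \<open>q \<in> E\<close> gE \<open>q \<noteq> g\<close>] by blast
    qed
    then have "path_image k \<inter> path_image h \<subseteq> {pathstart h}" using h k by auto
    then have "arc (k +++ h)" using h k by (intro arc_join) auto
    then show ?thesis using h k by (intro exI[of _ "k +++ h"]) (auto simp: path_image_join)
  qed
qed simp

text \<open>\<open>J\<close> is the closed curve traced by \<open>e\<close> and the path \<open>Q\<close>.\<close>

definition cycle_through :: "'e \<Rightarrow> 'e set \<Rightarrow> complex set \<Rightarrow> bool" where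
  "cycle_through e Q J \<longleftrightarrow> Q \<subseteq> E - {e} \<and> even_edges ends (insert e Q) \<and>
     J = (\<Union>q\<in>insert e Q. path_image (\<gamma> q)) \<and> connected (\<Union>q\<in>Q. path_image (\<gamma> q)) \<and>
     pos ` endpoints ends e \<subseteq> (\<Union>q\<in>Q. path_image (\<gamma> q)) \<and>
     (\<exists>c. simple_path c \<and> pathfinish c = pathstart c \<and> path_image c = J)"

text \<open>The vertex set \<open>U\<close> is a certificate: it serves both for a parity count and
  for cutting the drawing into two disjoint pieces.\<close>

definition bridge :: "'e \<Rightarrow> bool" where
  "bridge e \<longleftrightarrow> (\<exists>U u w. endpoints ends e = {u, w} \<and> u \<in> U \<and> w \<notin> U \<and>
     (\<forall>g\<in>E - {e}. endpoints ends g \<subseteq> U \<or> endpoints ends g \<inter> U = {}))"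

text \<open>The vertices reachable from one end without \<open>e\<close> either contain the other
  end, and a path closes up with \<open>e\<close> to a Jordan curve, or they certify a
  bridge.\<close>

lemma cycle_or_bridge:
  assumes e: "e \<in> E"
  shows "bridge e \<or> (\<exists>Q J. cycle_through e Q J)"
proof -
  obtain u w where uw: "endpoints ends e = {u, w}" "u \<noteq> w" "u \<in> V" "w \<in> V"
    "pathstart (\<gamma> e) = pos u" "pathfinish (\<gamma> e) = pos w" using endpoints_edge[OF e] .
  define U where "U = {x. \<exists>S Q. simple_walk (E - {e}) ends u x S Q}"
  have closed: "endpoints ends g \<subseteq> U \<or> endpoints ends g \<inter> U = {}" if g: "g \<in> E - {e}" for g
  proof -
    obtain b c where bc: "endpoints ends g = {b, c}" unfolding endpoints_def by blast
    have step: "c \<in> U" if b: "b \<in> U" and bc: "endpoints ends g = {b, c}" for b c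
    proof -
      obtain S Q where S: "simple_walk (E - {e}) ends u b S Q" using b by (auto simp: U_def)
      then show ?thesis
        using simple_walk_prefix[OF S, of c] simple_walk.snoc[OF S g bc] unfolding U_def by blast
    qed
    show ?thesis using step[of b c] step[of c b] bc by (auto simp: insert_commute)
  qed
  have uU: "u \<in> U" using simple_walk.nil[of "E - {e}" ends u] unfolding U_def by blast
  show ?thesis
  proof (cases "w \<in> U")
    case False
    have "bridge e" unfolding bridge_def
      by (rule exI[of _ U], rule exI[of _ u], rule exI[of _ w]) (use uU uw(1) False closed in simp)
    then show ?thesis ..
  next
    case True
    then obtain S Q where S: "simple_walk (E - {e}) ends u w S Q" by (auto simp: U_def)
    then obtain g where g: "arc g" "pathstart g = pos u" "pathfinish g = pos w"
      "path_image g = (\<Union>q\<in>Q. path_image (\<gamma> q))"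
      using simple_walk_arc[OF S] uw by auto
    note b = simple_walk_basic[OF S]
    have ev: "even_edges ends (insert e Q)"
      unfolding even_edges_def using simple_walk_degree[OF S] b uw by (subst degree_insert) auto
    have meet: "path_image g \<inter> path_image (\<gamma> e) \<subseteq> {pos u, pos w}"
    proof -
      have "path_image (\<gamma> q) \<inter> path_image (\<gamma> e) \<subseteq> {pos u, pos w}" if "q \<in> Q" for q
      proof -
        have "q \<in> E" "q \<noteq> e" using that b(3) by auto
        then show ?thesis using edges_meet[OF \<open>q \<in> E\<close> e] uw(1) by auto
      qed
      then show ?thesis using g(4) by auto
    qed
    define c where "c = g +++ reversepath (\<gamma> e)"
    have "simple_path c"
      unfolding c_def using g uw meet arc_edge[OF e]
      by (intro simple_path_join_loop) (simp_all add: arc_reversepath)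
    moreover have "pathfinish c = pathstart c" using g uw by (simp add: c_def)
    moreover have "path_image c = (\<Union>q\<in>insert e Q. path_image (\<gamma> q))"
      unfolding c_def using g uw by (subst path_image_join) auto
    moreover have "connected (\<Union>q\<in>Q. path_image (\<gamma> q))"
      using connected_arc_image[OF g(1)] g(4) by simp
    moreover have "pos ` endpoints ends e \<subseteq> (\<Union>q\<in>Q. path_image (\<gamma> q))"
      using g uw pathstart_in_path_image[of g] pathfinish_in_path_image[of g] by simp
    ultimately have "cycle_through e Q (\<Union>q\<in>insert e Q. path_image (\<gamma> q))"
      using ev b(3) unfolding cycle_through_def by (intro conjI exI[of _ c]) auto
    then show ?thesis by blast
  qed
qed

text \<open>Sum the degrees over the side \<open>U\<close> of the bridge: every other edge
  contributes 0 or 2, the bridge contributes 1.\<close>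

lemma bridge_not_in_even:
  assumes "e \<in> E" "bridge e" "C \<subseteq> E" "even_edges ends C"
  shows "e \<notin> C"
proof
  assume eC: "e \<in> C"
  obtain U u w where U: "endpoints ends e = {u, w}" "u \<in> U" "w \<notin> U"
    "\<forall>g\<in>E - {e}. endpoints ends g \<subseteq> U \<or> endpoints ends g \<inter> U = {}"
    using assms by (auto simp: bridge_def)
  have fin: "finite (U \<inter> V)" "finite C" using finite_VE assms finite_subset by auto
  have "even (\<Sum>v\<in>U \<inter> V. degree C ends v)"
    using assms(4) by (intro dvd_sum) (auto simp: even_edges_def)
  then have "even (\<Sum>g\<in>C. card (endpoints ends g \<inter> (U \<inter> V)))" using sum_degree[OF fin] by metis
  moreover have "even (\<Sum>g\<in>C - {e}. card (endpoints ends g \<inter> (U \<inter> V)))"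
  proof (intro dvd_sum)
    fix g assume g: "g \<in> C - {e}"
    then have gE: "g \<in> E" "g \<noteq> e" using assms by auto
    obtain a b where ab: "endpoints ends g = {a, b}" "a \<noteq> b" "a \<in> V" "b \<in> V" using endpoints_edge[OF gE(1)] .
    have "endpoints ends g \<inter> (U \<inter> V) = {a, b} \<or> endpoints ends g \<inter> (U \<inter> V) = {}"
      using U(4) gE ab by blast
    then show "even (card (endpoints ends g \<inter> (U \<inter> V)))" using ab by auto
  qed
  moreover have "card (endpoints ends e \<inter> (U \<inter> V)) = 1"
  proof -
    obtain a b where "endpoints ends e = {a, b}" "a \<noteq> b" "a \<in> V" "b \<in> V" using endpoints_edge[OF assms(1)] .
    then have "u \<in> V" using U(1) by (auto simp: doubleton_eq_iff)
    then have "endpoints ends e \<inter> (U \<inter> V) = {u}" using U by auto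
    then show ?thesis by simp
  qed
  ultimately show False using fin eC by (simp add: sum.remove)
qed

lemma cycle_throughD:
  assumes c: "cycle_through e Q J" and e: "e \<in> E"
  shows "compact J" "J \<subseteq> draw E" "\<And>g. g \<in> insert e Q \<Longrightarrow> open_arc g \<subseteq> J"
    "\<And>g. g \<in> E - insert e Q \<Longrightarrow> J \<subseteq> draw (E - {g})"
    "connected (inside J)" "connected (outside J)"
    "\<And>x. x \<in> J \<Longrightarrow> x \<in> closure (inside J)" "\<And>x. x \<in> J \<Longrightarrow> x \<in> closure (outside J)"
    "open (inside J)" "open (outside J)"
proof -
  obtain p where p: "simple_path p" "pathfinish p = pathstart p" "path_image p = J"
    using c by (auto simp: cycle_through_def)
  note jc = Jordan_inside_outside[OF p(1,2), unfolded p(3)]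
  show "compact J" using p compact_simple_path_image by blast
  have Q: "Q \<subseteq> E - {e}" and J: "J = (\<Union>q\<in>insert e Q. path_image (\<gamma> q))"
    using c by (auto simp: cycle_through_def)
  show "J \<subseteq> draw E" using Q J e by (auto simp: drawing_def)
  show "open_arc g \<subseteq> J" if "g \<in> insert e Q" for g using that J by (auto simp: open_arc_def)
  show "J \<subseteq> draw (E - {g})" if "g \<in> E - insert e Q" for g
    using that J Q e by (auto simp: drawing_def)
  show "connected (inside J)" "connected (outside J)" "open (inside J)" "open (outside J)"
    using jc by auto
  show "x \<in> closure (inside J)" "x \<in> closure (outside J)" if "x \<in> J" for x
    using jc that by (auto simp: frontier_def)
qed

lemma connected_inside_or_outside:
  fixes J T :: "complex set"
  assumes "closed J" "connected T" "T \<inter> J = {}"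
  shows "T \<subseteq> inside J \<or> T \<subseteq> outside J"
proof -
  have "T \<subseteq> inside J \<union> outside J" using assms(3) union_with_inside union_with_outside
    by (metis ComplI disjoint_iff inside_Un_outside subsetI)
  then have "T \<inter> inside J = {} \<or> T \<inter> outside J = {}"
    using connectedD[OF assms(2) open_inside[OF assms(1)] open_outside[OF assms(1)]]
      inside_Int_outside[of J] by (metis Int_commute inf_bot_right inf_left_commute)
  then show ?thesis using \<open>T \<subseteq> _\<close> by blast
qed


lemma face_side:
  assumes "f \<in> faces" "closed J" "J \<subseteq> draw E"
  shows "f \<subseteq> inside J \<or> f \<subseteq> outside J"
  using connected_inside_or_outside[OF assms(2) face_props(2)[OF assms(1)]] face_props(4)[OF assms(1)] assms(3)
  by blast

text \<open>An edge of the cycle lies on \<open>J\<close>, all of whose points are limits of both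
  sides, so its open region meets both. The region of any other edge is connected, avoids
  \<open>J\<close> and stays on one side.\<close>

lemma cycle_dual_cut:
  assumes e: "e \<in> E" and c: "cycle_through e Q J"
  shows "dual_cut E near {f. f \<subseteq> inside J} = insert e Q"
proof -
  note J = cycle_throughD[OF c e]
  have Q: "Q \<subseteq> E - {e}" using c by (simp add: cycle_through_def)
  have cl: "closed J" using J(1) compact_imp_closed by blast
  have side: "\<exists>f\<in>near g. f \<subseteq> S" if g: "g \<in> insert e Q"
    and S: "S = inside J \<or> S = outside J" for g S
  proof -
    have gE: "g \<in> E" using g e Q by auto
    define p where "p = \<gamma> g (1/2)"
    have p: "p \<in> open_arc g" "p \<in> region g" "p \<in> J"
      using midpoint_open_arc[OF gE] region_props(3)[OF gE] J(3)[OF g] unfolding p_def by auto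
    have "p \<in> closure S" using J(7,8)[OF p(3)] S by auto
    then have "region g \<inter> S \<noteq> {}"
      using open_Int_closure_eq_empty[OF region_props(1)[OF gE], of S] p(2) by blast
    then obtain x where x: "x \<in> region g" "x \<in> S" by blast
    have "S \<inter> J = {}" using S by (elim disjE) simp_all
    then have "x \<notin> draw E"
      using x J(3)[OF g] region_props(4)[OF gE] draw_remove[OF order_refl gE] by auto
    then obtain f where f: "f \<in> faces" "x \<in> f" by (rule face_through)
    then have "f \<in> near g" using face_meets_region[OF gE f(1)] x by blast
    moreover have "f \<subseteq> S"
      using face_side[OF f(1) cl J(2)] f x S inside_Int_outside[of J] by blast
    ultimately show ?thesis by blast
  qed
  have "splits {f. f \<subseteq> inside J} (near g)" if g: "g \<in> insert e Q" for g
  proof -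
    obtain f1 where f1: "f1 \<in> near g" "f1 \<subseteq> inside J" using side[OF g, of "inside J"] by blast
    obtain f2 where f2: "f2 \<in> near g" "f2 \<subseteq> outside J" using side[OF g, of "outside J"] by blast
    have "f2 \<noteq> {}" using f2 face_props(3) by (auto simp: near_def)
    then have "\<not> f2 \<subseteq> inside J" using f2 inside_Int_outside[of J] by blast
    then show ?thesis using f1 f2 unfolding splits_def by blast
  qed
  moreover have "\<not> splits {f. f \<subseteq> inside J} (near g)" if g: "g \<in> E - insert e Q" for g
  proof -
    have gE: "g \<in> E" using g by blast
    have "region g \<subseteq> inside J \<or> region g \<subseteq> outside J"
      using connected_inside_or_outside[OF cl region_props(2)[OF gE]] region_props(4)[OF gE] J(4)[OF g] by blast
    then show ?thesis
    proof
      assume "region g \<subseteq> inside J"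
      then show ?thesis by (auto simp: splits_def near_def)
    next
      assume o: "region g \<subseteq> outside J"
      have "\<not> f \<subseteq> inside J" if "f \<in> near g" for f
      proof -
        have "f \<noteq> {}" "f \<subseteq> outside J" using that o face_props(3)[of f] by (auto simp: near_def)
        then show ?thesis using inside_Int_outside[of J] by blast
      qed
      then show ?thesis by (auto simp: splits_def)
    qed
  qed
  ultimately show ?thesis using e Q unfolding dual_cut_def by blast
qed

text \<open>Janiszewski's theorem applies to \<open>J\<close> and the drawing without
  \<open>e\<close>, which meet in the rest of the cycle, a connected set. The side \<open>S\<close>
  joins the two faces off \<open>J\<close>, and \<open>region e\<close> joins them off the other
  edges.\<close>

lemma near_cycle:
  assumes e: "e \<in> E" and c: "cycle_through e Q J"
    and f: "f \<in> near e" "f' \<in> near e" and S: "S = inside J \<or> S = outside J" "f \<subseteq> S" "f' \<subseteq> S"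
  shows "f = f'"
proof -
  note J = cycle_throughD[OF c e]
  have ff: "f \<in> faces" "f' \<in> faces" "f \<subseteq> region e" "f' \<subseteq> region e" using f by (auto simp: near_def)
  obtain x y where xy: "x \<in> f" "y \<in> f'" using face_props(3)[OF ff(1)] face_props(3)[OF ff(2)] by blast
  define R where "R = draw (E - {e})"
  define P where "P = (\<Union>q\<in>Q. path_image (\<gamma> q))"
  have P: "Q \<subseteq> E - {e}" "J = path_image (\<gamma> e) \<union> P" "pos ` endpoints ends e \<subseteq> P" "connected P"
    using c by (simp_all add: cycle_through_def P_def)
  have "P \<subseteq> R" using P(1) unfolding drawing_def P_def R_def by blast
  moreover have "J = open_arc e \<union> P" using P(2,3) unfolding open_arc_def by blast
  moreover have "open_arc e \<inter> R = {}" "draw E = open_arc e \<union> R"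
    unfolding R_def using open_arc_disjoint[OF order_refl e] draw_remove[OF order_refl e] by blast+
  ultimately have JR: "J \<inter> R = P" "J \<union> R = draw E" by auto
  have "S \<inter> J = {}" "connected S"
    using S J(5,6) by (elim disjE; simp)+
  then have 1: "connected_component (- J) x y"
    unfolding connected_component_def using S(2,3) xy by (intro exI[of _ S]) blast
  have 2: "connected_component (- R) x y"
    unfolding connected_component_def using xy ff region_props(2,4)[OF e] unfolding R_def by (intro exI[of _ "region e"]) blast
  have "closed R" unfolding R_def using compact_draw[of "E - {e}"] compact_imp_closed by blast
  then have "connected_component (- draw E) x y"
    using Janiszewski[of J R x y] J(1) P(4) JR 1 2 by simp
  then obtain T where T: "connected T" "T \<subseteq> - draw E" "x \<in> T" "y \<in> T" by (auto simp: connected_component_def)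
  then have "T \<subseteq> f" using face_maximal[OF ff(1) T(1)] xy by blast
  then show ?thesis using faces_eq[OF ff(1,2)] T xy by blast
qed

text \<open>Without \<open>e\<close> the drawing falls into two disjoint compact pieces, each
  meeting the arc of \<open>e\<close> in one point. The arc does not separate the plane, and
  attaching the pieces one by one satisfies Janiszewski's theorem both times, the intersection being
  a point.\<close>

lemma near_bridge:
  assumes e: "e \<in> E" and b: "bridge e" and f: "f \<in> near e" "f' \<in> near e"
  shows "f = f'"
proof -
  have ff: "f \<in> faces" "f' \<in> faces" "f \<subseteq> region e" "f' \<subseteq> region e" using f by (auto simp: near_def)
  obtain x y where xy: "x \<in> f" "y \<in> f'" using face_props(3)[OF ff(1)] face_props(3)[OF ff(2)] by blast
  obtain U u w where U: "endpoints ends e = {u, w}" "u \<in> U" "w \<notin> U"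
    "\<forall>g\<in>E - {e}. endpoints ends g \<subseteq> U \<or> endpoints ends g \<inter> U = {}"
    using b by (auto simp: bridge_def)
  obtain a b where "endpoints ends e = {a, b}" "a \<noteq> b" "a \<in> V" "b \<in> V" using endpoints_edge[OF e] .
  then have uw: "u \<in> V" "w \<in> V" using U(1) by (metis insertCI insertE singletonD)+
  define T where "T W = pos ` (V \<inter> W) \<union> (\<Union>g\<in>{g\<in>E - {e}. endpoints ends g \<subseteq> W}. path_image (\<gamma> g))" for W
  let ?A = "path_image (\<gamma> e)"
  have closed: "compact (T W)" for W
    unfolding T_def using finite_VE arc_edge
    by (auto intro!: compact_Un compact_UN intro: finite_imp_compact compact_arc_image)
  have TT: "T U \<union> T (- U) = draw (E - {e})"
    using U(4) unfolding T_def drawing_def by blast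
  have ep: "endpoints ends g \<subseteq> V" if "g \<in> E" for g
    by (rule endpoints_edge[OF that]) simp
  have posI: "pos ` (V \<inter> A) \<inter> pos ` (V \<inter> B) \<subseteq> pos ` (V \<inter> (A \<inter> B))" for A B
    using pos_eq by auto
  have AT: "?A \<inter> T W \<subseteq> pos ` (V \<inter> ({u, w} \<inter> W))" for W
  proof -
    have "?A \<inter> pos ` (V \<inter> W) \<subseteq> pos ` (V \<inter> ({u, w} \<inter> W))"
      using edge_vertices[OF e] posI[of "{u, w}" W] U(1) uw by auto
    moreover have "?A \<inter> path_image (\<gamma> g) \<subseteq> pos ` (V \<inter> ({u, w} \<inter> W))"
      if "g \<in> E - {e}" "endpoints ends g \<subseteq> W" for g
      using edges_meet[OF e, of g] that U(1) uw by auto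
    ultimately show ?thesis unfolding T_def by blast
  qed
  have AU: "?A \<inter> T U = {pos u}" "?A \<inter> T (- U) = {pos w}"
  proof -
    have "V \<inter> ({u, w} \<inter> U) = {u}" "V \<inter> ({u, w} \<inter> - U) = {w}" using U uw by auto
    then have "?A \<inter> T U \<subseteq> {pos u}" "?A \<inter> T (- U) \<subseteq> {pos w}"
      using AT[of U] AT[of "- U"] by simp_all
    moreover have "pos u \<in> ?A" "pos w \<in> ?A" using pos_endpoints_path_image[OF e] U(1) by simp_all
    moreover have "pos u \<in> T U" "pos w \<in> T (- U)" using uw U unfolding T_def by simp_all
    ultimately show "?A \<inter> T U = {pos u}" "?A \<inter> T (- U) = {pos w}" by blast+
  qed
  have T12: "T U \<inter> T (- U) = {}"
  proof -
    have 1: "pos ` (V \<inter> U) \<inter> pos ` (V \<inter> - U) = {}" using posI[of U "- U"] by auto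
    have 2: "pos ` (V \<inter> W) \<inter> path_image (\<gamma> g) = {}"
      if g: "g \<in> E - {e}" and W: "endpoints ends g \<subseteq> - W" for g W
    proof -
      have "pos ` (V \<inter> W) \<inter> path_image (\<gamma> g) \<subseteq> pos ` (V \<inter> W) \<inter> pos ` (V \<inter> - W)"
        using edge_vertices[of g] g W ep[of g] by blast
      then show ?thesis using posI[of W "- W"] by auto
    qed
    have 3: "path_image (\<gamma> g) \<inter> path_image (\<gamma> h) = {}"
      if "g \<in> E - {e}" "h \<in> E - {e}" "endpoints ends g \<subseteq> U" "endpoints ends h \<subseteq> - U" for g h
    proof -
      have gh: "endpoints ends g \<inter> endpoints ends h = {}" using that by blast
      have "endpoints ends g \<noteq> {}" by (simp add: endpoints_def)
      then have "g \<noteq> h" using gh by auto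
      then show ?thesis using edges_meet[of g h] that gh by simp
    qed
    show ?thesis
    proof (rule equals0I)
      fix x assume x: "x \<in> T U \<inter> T (- U)"
      have cases: "x \<in> pos ` (V \<inter> W) \<or> (\<exists>g. g \<in> E - {e} \<and> endpoints ends g \<subseteq> W \<and> x \<in> path_image (\<gamma> g))"
        if "x \<in> T W" for W using that unfolding T_def by blast
      from cases[of U] x have "x \<in> pos ` (V \<inter> U) \<or> (\<exists>g. g \<in> E - {e} \<and> endpoints ends g \<subseteq> U \<and> x \<in> path_image (\<gamma> g))"
        by simp
      then show False
      proof (elim disjE exE conjE)
        assume "x \<in> pos ` (V \<inter> U)"
        then show False using 1 2[of _ U] cases[of "- U"] x by blast
      next
        fix g assume g: "g \<in> E - {e}" "endpoints ends g \<subseteq> U" "x \<in> path_image (\<gamma> g)"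
        show False
          using 2[OF g(1), of "- U"] 3[OF g(1) _ g(2)] cases[of "- U"] x g(2,3) by auto
      qed
    qed
  qed
  have R: "connected_component (- draw (E - {e})) x y"
    unfolding connected_component_def using xy ff region_props(2,4)[OF e] by (intro exI[of _ "region e"]) auto
  have R': "connected_component (- T W) x y" if "W = U \<or> W = - U" for W
  proof (rule connected_component_of_subset[OF R])
    show "- draw (E - {e}) \<subseteq> - T W" using TT that by blast
  qed
  have "?A \<subseteq> draw E" using e by (auto simp: drawing_def)
  then have "x \<in> - ?A" "y \<in> - ?A" using xy face_props(4)[OF ff(1)] face_props(4)[OF ff(2)] by blast+
  moreover have "connected (- ?A)" using connected_arc_complement[OF arc_edge[OF e]] by simp
  ultimately have "connected_component (- ?A) x y"
    unfolding connected_component_def by (intro exI[of _ "- ?A"]) simp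
  then have "connected_component (- (?A \<union> T U)) x y"
    using AU(1) R'[of U] closed[of U] arc_edge[OF e]
    by (intro Janiszewski[of ?A "T U"]) (simp_all add: compact_arc_image compact_imp_closed)
  moreover have "(?A \<union> T U) \<inter> T (- U) = {pos w}" using T12 AU(2) by blast
  ultimately have "connected_component (- (?A \<union> T U \<union> T (- U))) x y"
    using R'[of "- U"] closed arc_edge[OF e]
    by (intro Janiszewski[of "?A \<union> T U" "T (- U)"]) (simp_all add: compact_arc_image compact_imp_closed compact_Un)
  moreover have "?A \<union> T U \<union> T (- U) = draw E" using TT e by (auto simp: drawing_def)
  ultimately have "connected_component (- draw E) x y" by simp
  then obtain M where M: "connected M" "M \<subseteq> - draw E" "x \<in> M" "y \<in> M" by (auto simp: connected_component_def)
  then have "M \<subseteq> f" using face_maximal[OF ff(1) M(1)] xy by blast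
  then show ?thesis using faces_eq[OF ff(1,2)] M xy by blast
qed

lemma near_subset_pair:
  assumes e: "e \<in> E" shows "\<exists>a b. near e \<subseteq> {a, b}"
proof (cases "bridge e")
  case True
  then have "near e \<subseteq> {SOME f. f \<in> near e, SOME f. f \<in> near e}"
    using near_bridge[OF e] someI[of "\<lambda>f. f \<in> near e"] by blast
  then show ?thesis by blast
next
  case False
  then obtain Q J where c: "cycle_through e Q J" using cycle_or_bridge[OF e] by blast
  note J = cycle_throughD[OF c e]
  \<comment> \<open>Names the face beside \<open>e\<close> on the side \<open>S\<close>. Without
    such a face the value is arbitrary, which is harmless in an upper bound.\<close>
  define a where "a S = (SOME f. f \<in> near e \<and> f \<subseteq> S)" for S
  have a: "f = a S" if "f \<in> near e" "f \<subseteq> S" "S = inside J \<or> S = outside J" for f S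
  proof -
    have "a S \<in> near e \<and> a S \<subseteq> S" unfolding a_def using that someI[of "\<lambda>f. f \<in> near e \<and> f \<subseteq> S" f] by blast
    then show ?thesis using near_cycle[OF e c that(1) _ that(3,2)] by blast
  qed
  have "f = a (inside J) \<or> f = a (outside J)" if f: "f \<in> near e" for f
  proof -
    have "f \<in> faces" using f by (simp add: near_def)
    from face_side[OF this compact_imp_closed[OF J(1)] J(2)] show ?thesis
      using a[OF f, of "inside J"] a[OF f, of "outside J"] by auto
  qed
  then have "near e \<subseteq> {a (inside J), a (outside J)}" by auto
  then show ?thesis by blast
qed


lemma dual_cut_edge_cycle:
  assumes e: "e \<in> E" and split: "splits X (near e)"
  shows "\<exists>Q J. cycle_through e Q J"
proof -
  have "\<not> bridge e"
    using split near_bridge[OF e] unfolding splits_def by blast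
  then show ?thesis using cycle_or_bridge[OF e] by blast
qed

section \<open>Duality of even sets and cuts, by removing edges\<close>

text \<open>Restoring an edge \<open>e\<close> cuts one face of the graph without \<open>e\<close> and leaves the other ones
  unchanged.\<close>

lemma restore_edge:
  assumes e: "e \<in> E"
  defines "faces0 \<equiv> plane_graph.faces V (E - {e}) pos \<gamma>"
    and "near0 \<equiv> plane_graph.near V (E - {e}) pos \<gamma>"
  shows "\<exists>Y. dual_cut E near Y = dual_cut (E - {e}) near0 X" (is ?lift)
    and "\<not> splits X (near e) \<Longrightarrow> \<exists>Y. dual_cut E near X = dual_cut (E - {e}) near0 Y"
      (is "_ \<Longrightarrow> ?lower")
proof -
  interpret G: plane_graph V "E - {e}" ends pos \<gamma> by (rule remove_edges) blast
  have faces0: "faces0 = G.faces" and near0: "near0 = G.near" by (simp_all add: faces0_def near0_def)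
  have reg: "region e \<in> G.faces" using region_in_components[OF e] by (simp add: G.faces_def)
  have dr: "draw (E - {e} - {g}) \<subseteq> draw (E - {g})" for g by (intro draw_mono) auto
  have sup: "\<exists>f'\<in>G.faces. f \<subseteq> f'" if f: "f \<in> faces" for f
  proof -
    obtain x where x: "x \<in> f" using face_props(3)[OF f] by blast
    have no: "f \<inter> draw (E - {e}) = {}" using face_props(4)[OF f] draw_mono[of "E - {e}" E] by blast
    then have "x \<notin> draw (E - {e})" using x by blast
    then obtain f' where f': "f' \<in> G.faces" "x \<in> f'" by (rule G.face_through)
    have "f \<subseteq> f'" using G.face_maximal[OF f'(1) face_props(2)[OF f] no] x f'(2) by blast
    then show ?thesis using f' by blast
  qed
  have uniq: "f1 = f2" if "f1 \<in> G.faces" "f2 \<in> G.faces" "f \<in> faces" "f \<subseteq> f1" "f \<subseteq> f2" for f f1 f2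
    using that face_props(3)[OF that(3)] G.faces_eq[OF that(1,2)] by blast
  have down: "\<exists>f'\<in>G.near g. f \<subseteq> f'" if g: "g \<in> E" "g \<noteq> e" and f: "f \<in> near g" for f g
  proof -
    have ff: "f \<in> faces" "f \<subseteq> region g" using f by (auto simp: near_def)
    have gE: "g \<in> E - {e}" using g by blast
    obtain f' where f': "f' \<in> G.faces" "f \<subseteq> f'" using sup[OF ff(1)] by blast
    have "G.region g \<inter> region g \<noteq> {}"
      using G.region_props(3)[OF gE] region_props(3)[OF g(1)] midpoint_open_arc[OF g(1)] by blast
    then have "region g \<subseteq> G.region g"
      using G.region_maximal[OF gE region_props(2)[OF g(1)]] region_props(4)[OF g(1)] dr[of g] by blast
    then have "f' \<inter> G.region g \<noteq> {}" using ff f' face_props(3)[OF ff(1)] by blast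
    then have "f' \<in> G.near g" using G.face_meets_region[OF gE f'(1)] by blast
    then show ?thesis using f' by blast
  qed
  have up: "\<exists>f\<in>near g. f \<subseteq> f'" if g: "g \<in> E" "g \<noteq> e" and f': "f' \<in> G.near g" for f' g
  proof -
    have gE: "g \<in> E - {e}" using g by blast
    have ff': "f' \<in> G.faces" using f' by (auto simp: G.near_def)
    obtain p where p: "p \<in> closure f'" "p \<in> open_arc g" using G.near_touches[OF gE f'] by blast
    have "p \<in> region g" using p(2) region_props(3)[OF g(1)] by blast
    then have "region g \<inter> f' \<noteq> {}"
      using p(1) open_Int_closure_eq_empty[OF region_props(1)[OF g(1)], of f'] by blast
    then obtain x where x: "x \<in> region g" "x \<in> f'" by blast
    have "x \<notin> draw (E - {e})" using x(2) G.face_props(4)[OF ff'] by blast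
    moreover have "x \<notin> draw (E - {g})" using x(1) region_props(4)[OF g(1)] by blast
    moreover have "draw E \<subseteq> draw (E - {e}) \<union> draw (E - {g})" using g(2) by (auto simp: drawing_def)
    ultimately have "x \<notin> draw E" by blast
    then obtain f where f: "f \<in> faces" "x \<in> f" by (rule face_through)
    have "f \<in> near g" using face_meets_region[OF g(1) f(1)] f x by blast
    moreover have "f \<subseteq> f'"
      using G.face_maximal[OF ff' face_props(2)[OF f(1)]] face_props(4)[OF f(1)] f(2) x(2)
        draw_mono[of "E - {e}" E] by blast
    ultimately show ?thesis by blast
  qed
  \<comment> \<open>Each face lies in one coarse face, that is, a face of the graph without
    \<open>e\<close>. By \<open>down\<close> and \<open>up\<close> the faces beside another edge
    correspond to the coarse ones, so lifting preserves its status; \<open>e\<close> is never cut,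
    since \<open>region e\<close> is one coarse face.\<close>
  define lift where "lift X = {f\<in>faces. \<exists>f'\<in>X \<inter> G.faces. f \<subseteq> f'}" for X
  have lift_iff: "f \<in> lift X \<longleftrightarrow> f' \<in> X" if "f \<in> faces" "f' \<in> G.faces" "f \<subseteq> f'" for f f' X
    using that uniq[OF _ that(2,1) _ that(3)] unfolding lift_def by blast
  have splits_lift: "splits (lift X) (near g) \<longleftrightarrow> splits X (G.near g)" if g: "g \<in> E" "g \<noteq> e" for g X
  proof -
    have ex: "(\<exists>f\<in>near g. P (f \<in> lift X)) \<longleftrightarrow> (\<exists>f'\<in>G.near g. P (f' \<in> X))" for P :: "bool \<Rightarrow> bool"
    proof
      assume "\<exists>f\<in>near g. P (f \<in> lift X)"
      then obtain f where f: "f \<in> near g" "P (f \<in> lift X)" by blast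
      then obtain f' where f': "f' \<in> G.near g" "f \<subseteq> f'" using down[OF g] by blast
      then show "\<exists>f'\<in>G.near g. P (f' \<in> X)"
        using f lift_iff[of f f' X] by (auto simp: near_def G.near_def)
    next
      assume "\<exists>f'\<in>G.near g. P (f' \<in> X)"
      then obtain f' where f': "f' \<in> G.near g" "P (f' \<in> X)" by blast
      then obtain f where f: "f \<in> near g" "f \<subseteq> f'" using up[OF g] by blast
      then show "\<exists>f\<in>near g. P (f \<in> lift X)"
        using f' lift_iff[of f f' X] by (auto simp: near_def G.near_def)
    qed
    show ?thesis using ex[of "\<lambda>b. b"] ex[of Not] by (simp add: splits_def)
  qed
  have "\<not> splits (lift X) (near e)" for X
    using reg lift_iff[of _ "region e" X] by (auto simp: splits_def near_def)
  then have dc: "dual_cut E near (lift X) = dual_cut (E - {e}) near0 X" for X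
    using splits_lift near0 by (auto simp: dual_cut_def)
  then show ?lift by blast
  show ?lower if ns: "\<not> splits X (near e)"
  proof -
    \<comment> \<open>Every coarse face except \<open>region e\<close> is itself a face, and
      \<open>X\<close> holds all or none of the faces inside \<open>region e\<close>. So
      \<open>X\<close> and the lift of \<open>Y\<close> contain the same faces.\<close>
    define Y where "Y = {f'\<in>G.faces. \<exists>f\<in>X \<inter> faces. f \<subseteq> f'}"
    have "f \<in> lift Y \<longleftrightarrow> f \<in> X" if f: "f \<in> faces" for f
    proof -
      obtain f' where f': "f' \<in> G.faces" "f \<subseteq> f'" using sup[OF f] by blast
      have iff: "f \<in> lift Y \<longleftrightarrow> (\<exists>f2\<in>X \<inter> faces. f2 \<subseteq> f')"
        using lift_iff[OF f f', of Y] f'(1) by (simp add: Y_def)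
      have "f \<in> X" if f2: "f2 \<in> X" "f2 \<in> faces" "f2 \<subseteq> f'" for f2
      proof (cases "f' = region e")
        case True
        then have "f \<in> near e" "f2 \<in> near e" using f f' f2 by (auto simp: near_def)
        then show ?thesis using ns f2(1) unfolding splits_def by blast
      next
        case False
        then have "f' \<inter> region e = {}" using G.faces_eq[OF f'(1) reg] by blast
        then have "f' \<inter> draw E = {}"
          using region_props(3)[OF e] draw_remove[OF order_refl e] G.face_props(4)[OF f'(1)] by auto
        then have "f' \<subseteq> f" "f' \<subseteq> f2"
          using face_maximal[OF f G.face_props(2)[OF f'(1)]] face_maximal[OF f2(2) G.face_props(2)[OF f'(1)]]
            f'(2) f2(3) face_props(3)[OF f] face_props(3)[OF f2(2)] by blast+
        then show ?thesis using f'(2) f2 by auto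
      qed
      then show ?thesis using iff f f' by blast
    qed
    then have "dual_cut E near (lift Y) = dual_cut E near X"
      unfolding dual_cut_def splits_def near_def by auto
    then show ?thesis using dc by metis
  qed
qed

lemma even_sym_diff_cycle:
  assumes "cycle_through e Q J" "C \<subseteq> E" "e \<in> C"
  shows "even_edges ends (sym_diff (insert e Q) C) \<longleftrightarrow> even_edges ends C"
    "sym_diff (insert e Q) C \<subseteq> E - {e}"
proof -
  have c: "Q \<subseteq> E - {e}" "even_edges ends (insert e Q)" using assms(1) by (simp_all add: cycle_through_def)
  have "insert e Q \<subseteq> E" using c(1) assms by blast
  then have "finite (insert e Q)" by (rule finite_subset) (rule finite_VE(2))
  moreover have "finite C" using assms(2) by (rule finite_subset) (rule finite_VE(2))
  ultimately show "even_edges ends (sym_diff (insert e Q) C) \<longleftrightarrow> even_edges ends C"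
    using c(2) by (rule even_edges_sym_diff)
  show "sym_diff (insert e Q) C \<subseteq> E - {e}" using c(1) assms by blast
qed

end

text \<open>Induction on the edges, outside the locale because \<open>near\<close> varies with
  \<open>E\<close>. Sets avoiding \<open>e\<close> transfer from the graph without \<open>e\<close>.
  If \<open>e\<close> lies on a cycle, adding this cycle, both even and a dual cut, removes
  \<open>e\<close> from the set; a bridge is in no even set and in no dual cut.\<close>

lemma plane_graph_even_iff_dual_cut:
  assumes "plane_graph V E ends pos \<gamma>" "C \<subseteq> E"
  shows "even_edges ends C \<longleftrightarrow> (\<exists>X. C = dual_cut E (plane_graph.near V E pos \<gamma>) X)"
proof -
  have "\<forall>C\<subseteq>E. even_edges ends C \<longleftrightarrow> (\<exists>X. C = dual_cut E (plane_graph.near V E pos \<gamma>) X)"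
    using assms(1)
  proof (induction "card E" arbitrary: E)
    case 0
    interpret plane_graph V E ends pos \<gamma> by (rule 0)
    have "E = {}" using 0 finite_VE by simp
    then show ?case by (simp add: even_edges_def degree_def dual_cut_def)
  next
    case (Suc n)
    interpret plane_graph V E ends pos \<gamma> by (rule Suc.prems)
    obtain e where e: "e \<in> E" using Suc.hyps(2) by fastforce
    define near0 where "near0 = plane_graph.near V (E - {e}) pos \<gamma>"
    have "n = card (E - {e})" using Suc.hyps(2) e finite_VE by simp
    then have IH: "even_edges ends C \<longleftrightarrow> (\<exists>X. C = dual_cut (E - {e}) near0 X)" if "C \<subseteq> E - {e}" for C
      using Suc.hyps(1)[of "E - {e}"] remove_edges[of "E - {e}"] that unfolding near0_def by blast
    note restore = restore_edge[OF e, folded near0_def]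
    have without: "even_edges ends C \<longleftrightarrow> (\<exists>X. C = dual_cut E near X)" if C: "C \<subseteq> E - {e}" for C
    proof
      assume "even_edges ends C"
      then show "\<exists>X. C = dual_cut E near X" using IH[OF C] restore(1) by metis
    next
      assume "\<exists>X. C = dual_cut E near X"
      then obtain X where X: "C = dual_cut E near X" by blast
      then have "\<not> splits X (near e)" using C e by (auto simp: dual_cut_def)
      then obtain Y where "C = dual_cut (E - {e}) near0 Y" using restore(2) X by blast
      then show "even_edges ends C" using IH[OF C] by blast
    qed
    show ?case
    proof (intro allI impI)
      fix C assume C: "C \<subseteq> E"
      show "even_edges ends C \<longleftrightarrow> (\<exists>X. C = dual_cut E near X)"
      proof (cases "e \<in> C \<and> (\<exists>Q J. cycle_through e Q J)")
        case False
        moreover have "e \<notin> C" if "\<nexists>Q J. cycle_through e Q J" "even_edges ends C \<or> (\<exists>X. C = dual_cut E near X)"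
          using that cycle_or_bridge[OF e] bridge_not_in_even[OF e _ C] dual_cut_edge_cycle[OF e]
          by (auto simp: dual_cut_def)
        ultimately show ?thesis using without[of C] C by blast
      next
        case True
        then obtain Q J where c: "cycle_through e Q J" and eC: "e \<in> C" by blast
        define Z where "Z = {f. f \<subseteq> inside J}"
        have Z: "dual_cut E near Z = insert e Q" unfolding Z_def by (rule cycle_dual_cut[OF e c])
        have sd: "dual_cut E near (sym_diff Z X) = sym_diff (insert e Q) (dual_cut E near X)" for X
          unfolding Z[symmetric] by (rule dual_cut_sym_diff) (rule near_subset_pair)
        have "(\<exists>X. C = dual_cut E near X) \<longleftrightarrow> (\<exists>X. sym_diff (insert e Q) C = dual_cut E near X)"
        proof
          assume "\<exists>X. C = dual_cut E near X"
          then show "\<exists>X. sym_diff (insert e Q) C = dual_cut E near X" using sd by blast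
        next
          assume "\<exists>X. sym_diff (insert e Q) C = dual_cut E near X"
          then obtain X where X: "sym_diff (insert e Q) C = dual_cut E near X" by blast
          have "C = sym_diff (insert e Q) (sym_diff (insert e Q) C)" by blast
          also have "\<dots> = dual_cut E near (sym_diff Z X)" unfolding X sd ..
          finally show "\<exists>X. C = dual_cut E near X" ..
        qed
        then show ?thesis
          using even_sym_diff_cycle[OF c C eC] without[of "sym_diff (insert e Q) C"] by blast
      qed
    qed
  qed
  then show ?thesis using assms(2) by simp
qed

context plane_graph
begin

section \<open>Faces at a vertex and the outer face\<close>

text \<open>A connected set with two points has no isolated point, and dropping the two ends of the
  arc does not affect limit points.\<close>

lemma open_arc_near_vertex:
  assumes g: "g \<in> star E ends v" and r: "r > 0"
  shows "\<exists>x\<in>open_arc g. x \<in> ball (pos v) r - {pos v}"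
proof -
  have gE: "g \<in> E" "v \<in> endpoints ends g" using g by (auto simp: in_star)
  obtain a b where ab: "endpoints ends g = {a, b}" "a \<noteq> b" "a \<in> V" "b \<in> V" using endpoints_edge[OF gE(1)] .
  have sub: "pos ` endpoints ends g \<subseteq> path_image (\<gamma> g)" by (rule pos_endpoints_path_image[OF gE(1)])
  have "pos v islimpt path_image (\<gamma> g)"
  proof (rule connected_imp_perfect)
    show "connected (path_image (\<gamma> g))" using arc_edge[OF gE(1)] by (rule connected_arc_image)
    show "pos v \<in> path_image (\<gamma> g)" using sub gE(2) by blast
    show "path_image (\<gamma> g) \<noteq> {x}" for x
      using sub ab pos_eq[OF ab(3,4)] by auto
  qed
  moreover have "path_image (\<gamma> g) = pos ` endpoints ends g \<union> open_arc g"
    using sub unfolding open_arc_def by blast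
  moreover have "finite (pos ` endpoints ends g)" using ab by simp
  ultimately have "pos v islimpt open_arc g" using islimpt_Un_finite by metis
  then obtain x where "x \<in> open_arc g" "x \<noteq> pos v" "dist x (pos v) < r"
    using r unfolding islimpt_approachable by blast
  then show ?thesis by (auto simp: dist_commute)
qed

text \<open>A small punctured disc around a vertex is connected and covered by the open regions of
  the incident edges and the other faces.\<close>

lemma faces_around_vertex:
  assumes v: "v \<in> V" and A: "A \<subseteq> star E ends v" "A \<noteq> {}"
    and sep: "\<And>g h. g \<in> A \<Longrightarrow> h \<in> star E ends v - A \<Longrightarrow> near g \<inter> near h = {}"
  shows "A = star E ends v" and "\<And>f. f \<in> faces \<Longrightarrow> pos v \<in> closure f \<Longrightarrow> \<exists>g\<in>A. f \<in> near g"
proof -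
  have starE: "star E ends v \<subseteq> E" by (auto simp: star_def)
  \<comment> \<open>The part of the drawing away from \<open>v\<close>; a small disc around
    \<open>pos v\<close> avoids it and meets only incident arcs.\<close>
  define K where "K = pos ` (V - {v}) \<union> (\<Union>g\<in>E - star E ends v. path_image (\<gamma> g))"
  have "compact K"
    unfolding K_def using finite_VE arc_edge
    by (auto intro!: compact_Un compact_UN intro: finite_imp_compact compact_arc_image)
  moreover have "pos v \<notin> K"
  proof
    assume "pos v \<in> K"
    then consider "pos v \<in> pos ` (V - {v})" | g where "g \<in> E" "g \<notin> star E ends v" "pos v \<in> path_image (\<gamma> g)"
      unfolding K_def by blast
    then show False
    proof cases
      case 1
      then show ?thesis using pos_eq v by auto
    next
      case 2
      obtain a b where ab: "endpoints ends g = {a, b}" "a \<noteq> b" "a \<in> V" "b \<in> V" using endpoints_edge[OF 2(1)] .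
      have "pos v \<in> pos ` endpoints ends g" using edge_vertices[OF 2(1)] 2(3) v by blast
      then have "v \<in> endpoints ends g" using ab pos_eq v by auto
      then show ?thesis using 2 by (simp add: in_star)
    qed
  qed
  ultimately obtain r where r: "r > 0" "ball (pos v) r \<subseteq> - K"
    using open_contains_ball[of "- K"] compact_imp_closed[of K] by (auto simp: open_Compl)
  define B where "B = ball (pos v) r - {pos v}"
  have "connected B" unfolding B_def by (rule connected_punctured_ball) simp
  \<comment> \<open>Disjoint open sets covering the punctured disc: a common point of two regions,
    one from \<open>A\<close> and one from the rest, would be on neither arc, hence in a common
    face. As \<open>W1\<close> meets the connected disc, \<open>W2\<close> cannot.\<close>
  define W1 where "W1 = \<Union>(region ` A)"
  define W2 where "W2 = \<Union>(region ` (star E ends v - A)) \<union> \<Union>{f\<in>faces. \<forall>g\<in>A. f \<notin> near g}"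
  have "open W1" unfolding W1_def using region_props(1) A(1) starE by (intro open_Union) blast
  moreover have "open W2"
    unfolding W2_def using region_props(1) starE face_props(1) by (intro open_Un open_Union) blast+
  moreover have "B \<subseteq> W1 \<union> W2"
  proof
    fix x assume x: "x \<in> B"
    then have xK: "x \<notin> K" "x \<noteq> pos v" using r(2) by (auto simp: B_def)
    show "x \<in> W1 \<union> W2"
    proof (cases "x \<in> draw E")
      case True
      have xV: "x \<notin> pos ` V" using xK unfolding K_def by blast
      then obtain g where g: "g \<in> E" "x \<in> path_image (\<gamma> g)" using True unfolding drawing_def by blast
      then have gs: "g \<in> star E ends v" using xK unfolding K_def by blast
      obtain a b where "endpoints ends g = {a, b}" "a \<noteq> b" "a \<in> V" "b \<in> V" using endpoints_edge[OF g(1)] .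
      then have "x \<in> open_arc g" using xV g(2) unfolding open_arc_def by auto
      then have "x \<in> region g" using region_props(3)[OF g(1)] by blast
      then show ?thesis using gs unfolding W1_def W2_def by blast
    next
      case False
      then obtain f where f: "f \<in> faces" "x \<in> f" by (rule face_through)
      show ?thesis
      proof (cases "\<exists>g\<in>A. f \<in> near g")
        case True
        then show ?thesis using f(2) unfolding W1_def near_def by blast
      next
        case False
        then show ?thesis using f unfolding W2_def by blast
      qed
    qed
  qed
  moreover have "W1 \<inter> W2 = {}"
  proof (rule equals0I)
    fix x assume x: "x \<in> W1 \<inter> W2"
    then obtain g where g: "g \<in> A" "x \<in> region g" unfolding W1_def by blast
    have gE: "g \<in> E" using g(1) A(1) starE by blast
    consider h where "h \<in> star E ends v - A" "x \<in> region h"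
      | f where "f \<in> faces" "\<forall>g\<in>A. f \<notin> near g" "x \<in> f"
      using x unfolding W2_def by blast
    then show False
    proof cases
      case 1
      have hE: "h \<in> E" "g \<noteq> h" using 1 g(1) starE by blast+
      have "open_arc g \<subseteq> draw (E - {h})" "open_arc h \<subseteq> draw (E - {g})"
        using gE hE unfolding open_arc_def drawing_def by blast+
      then have "x \<notin> open_arc g" "x \<notin> open_arc h"
        using region_props(4)[OF gE] region_props(4)[OF hE(1)] g(2) 1(2) by blast+
      then obtain f f' where f: "f \<in> near g" "x \<in> f" "f' \<in> near h" "x \<in> f'"
        using g(2) 1(2) unfolding region_eq[OF gE] region_eq[OF hE(1)] by blast
      then have "f = f'" using faces_eq[of f f'] by (simp add: near_def)
      then show ?thesis using sep[OF g(1) 1(1)] f by blast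
    next
      case 2
      then have "f \<in> near g" using face_meets_region[OF gE] g(2) by blast
      then show ?thesis using 2(2) g(1) by blast
    qed
  qed
  ultimately have "W1 \<inter> B = {} \<or> W2 \<inter> B = {}"
    using connectedD[OF \<open>connected B\<close>, of W1 W2] by simp
  moreover have meets: "region g \<inter> B \<noteq> {}" if g: "g \<in> star E ends v" for g
  proof -
    have "g \<in> E" using g starE by blast
    then show ?thesis
      using open_arc_near_vertex[OF g r(1)] region_props(3)[of g] unfolding B_def by blast
  qed
  moreover obtain g0 where "g0 \<in> A" using A(2) by blast
  then have "W1 \<inter> B \<noteq> {}" using meets[of g0] A(1) unfolding W1_def by blast
  ultimately have W2: "W2 \<inter> B = {}" by blast
  show "A = star E ends v"
  proof (rule ccontr)
    assume "A \<noteq> star E ends v"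
    then obtain h where "h \<in> star E ends v - A" using A(1) by blast
    then show False using meets[of h] W2 unfolding W2_def by blast
  qed
  show "\<exists>g\<in>A. f \<in> near g" if f: "f \<in> faces" "pos v \<in> closure f" for f
  proof (rule ccontr)
    assume "\<not> ?thesis"
    then have "f \<subseteq> W2" using f(1) unfolding W2_def by blast
    have "ball (pos v) r \<inter> f \<noteq> {}"
    proof -
      have "pos v \<in> ball (pos v) r \<inter> closure f" using f(2) r(1) by simp
      then have "ball (pos v) r \<inter> closure f \<noteq> {}" by blast
      then show ?thesis using open_Int_closure_eq_empty[of "ball (pos v) r" f] by simp
    qed
    then obtain x where x: "x \<in> ball (pos v) r" "x \<in> f" by blast
    have "pos v \<in> draw E" using v by (simp add: drawing_def)
    then have "x \<noteq> pos v" using face_props(4)[OF f(1)] x(2) by blast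
    then show False using x W2 \<open>f \<subseteq> W2\<close> unfolding B_def by blast
  qed
qed

lemma star_outside: "v \<notin> V \<Longrightarrow> star E ends v = {}"
  using multigraph by (auto simp: star_def multigraph_def endpoints_def)

lemma face_structure_near: "face_structure E ends near"
  unfolding face_structure_def
proof (intro conjI allI impI ballI)
  fix C assume "C \<subseteq> E"
  then show "even_edges ends C \<longleftrightarrow> (\<exists>X. C = dual_cut E near X)"
    by (rule plane_graph_even_iff_dual_cut[OF plane_graph_axioms])
next
  fix v A assume A: "A \<subseteq> star E ends v \<and> A \<noteq> {} \<and> A \<noteq> star E ends v"
  then have "v \<in> V" using star_outside[of v] by blast
  then show "\<exists>g\<in>A. \<exists>h\<in>star E ends v - A. near g \<inter> near h \<noteq> {}"
    using faces_around_vertex(1)[of v A] A by blast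
qed (use finite_VE near_subset_pair in auto)

text \<open>The drawing is bounded, so its complement has exactly one unbounded component, and the
  union of all unbounded ones is a single face.\<close>

lemma outer_face_in_faces: "outer_face V E pos \<gamma> \<in> faces"
proof -
  have "bounded (draw E)" using compact_imp_bounded[OF compact_draw[OF order_refl]] .
  then have b: "bounded (- (- draw E))" by simp
  then obtain z where z: "z \<in> - draw E" "\<not> bounded (connected_component_set (- draw E) z)"
    using cobounded_unbounded_component[of "- draw E"] by blast
  have "outer_face V E pos \<gamma> = connected_component_set (- draw E) z"
  proof (rule set_eqI)
    fix x
    show "x \<in> outer_face V E pos \<gamma> \<longleftrightarrow> x \<in> connected_component_set (- draw E) z"
    proof
      assume x: "x \<in> outer_face V E pos \<gamma>"
      then have "connected_component_set (- draw E) x = connected_component_set (- draw E) z"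
        using cobounded_unique_unbounded_component[OF b] z(2) by (simp add: outer_face_def)
      moreover have "x \<in> connected_component_set (- draw E) x"
        using x by (simp add: outer_face_def connected_component_refl)
      ultimately show "x \<in> connected_component_set (- draw E) z" by blast
    next
      assume x: "x \<in> connected_component_set (- draw E) z"
      then have "connected_component_set (- draw E) x = connected_component_set (- draw E) z"
        using connected_component_eq by blast
      moreover have "x \<notin> draw E" using x connected_component_in[of "- draw E" z x] by simp
      ultimately show "x \<in> outer_face V E pos \<gamma>" using z(2) by (simp add: outer_face_def)
    qed
  qed
  then show ?thesis using z(1) by (simp add: faces_def componentsI)
qed

text \<open>An odd vertex is not internal, so it is in the closure of the outer face. Taking the
  whole star for \<open>A\<close> makes the separation hypothesis of
  \<open>faces_around_vertex\<close> vacuous and gives an edge beside that face.\<close>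

lemma odd_outer_near:
  assumes "inner_eulerian V E ends pos \<gamma>"
  shows "odd_outer E ends near (outer_face V E pos \<gamma>)"
  unfolding odd_outer_def
proof (intro conjI allI impI)
  fix v assume odd: "odd (degree E ends v)"
  then have ne: "star E ends v \<noteq> {}" by (auto simp: degree_eq_card_star)
  then have v: "v \<in> V" using star_outside by blast
  then have "pos v \<in> closure (outer_face V E pos \<gamma>)"
    using assms odd by (auto simp: inner_eulerian_def internal_vertex_def external_vertex_def frontier_def)
  then have "\<exists>g\<in>star E ends v. outer_face V E pos \<gamma> \<in> near g"
    using faces_around_vertex(2)[OF v order_refl ne _ outer_face_in_faces] by blast
  then show "outer_vertex E ends near (outer_face V E pos \<gamma>) v" by (simp add: outer_vertex_def)
qed (rule face_structure_near)

end

theorem theorem6p6: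
  fixes V :: "'v set" and E :: "'e set" and ends :: "'e \<Rightarrow> 'v \<times> 'v"
    and pos :: "'v \<Rightarrow> complex" and \<gamma> :: "'e \<Rightarrow> real \<Rightarrow> complex"
  assumes "multigraph V E ends"
    and "plane_embedding V E ends pos \<gamma>"
    and "bipartite E ends"
    and "inner_eulerian V E ends pos \<gamma>"
  shows "reducible (V, E, ends)"
proof -
  interpret plane_graph V E ends pos \<gamma>
    using assms(1,2) by (rule plane_graph.intro)
  have "reduction_invariant V E ends near (outer_face V E pos \<gamma>)"
    using assms(1,3) odd_outer_near[OF assms(4)] by (simp add: reduction_invariant_def)
  then show ?thesis by (rule reduction_invariant_reducible)
qed

end
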